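(* Let $f:\mathbb{R}^d\to\mathbb{R}$ be twice continuously differentiable and bounded from below, and let $f$ satisfy the local PL condition at a local minimizer $x_*$ of $f$. Let $\mu$ denote the smallest nonzero eigenvalue of $\nabla^2 f(x_* )$, let $\mathcal{S}:=\{x\in\mathbb{R}^d: x\text{ is a local minimizer of } f\text{ and } f(x)=f(x_* )\}$, and let $\gamma>0$. Then for every sufficiently small $\varepsilon>0$ there exist a sufficiently small open neighborhood $\mathcal{U}\subset\mathbb{R}^d\times\mathbb{R}^d$ of $(x_*,0)$ and a constant $C_\varepsilon>0$ (depending on $\varepsilon$, but not on $t$ or on the initial condition) such that for any initial condition $(x(0),\dot x(0))\in\mathcal{U}$ the trajectory $x(t)$ of $$\ddot x(t)+\gamma\dot x(t)+\nabla f(x(t))=0$$ converges to some local minimizer $x_*'\in\mathcal{S}$, and $$\|x(t)-x_*'\|\le C_\varepsilon\big(\|x(0)-x_*'\|+\|\dot x(0)\|\big)e^{-(\rho_\gamma-\varepsilon)t}\quad\text{for all } t\ge0,$$ where $$\rho_\gamma=\frac{\gamma-\sqrt{\max\{0,\gamma^2-4\mu\}}}{2}.$$ In particular, with the optimal damping parameter $\gamma=2\sqrt{\mu}$ (optimal in the sense of maximizing $\rho_\gamma$ over $\gamma>0$), the flow achieves the optimal exponential convergence rate $\rho_{\mathrm{opt}}=\sqrt{\mu}$, i.e. for every sufficiently small $\varepsilon>0$ and every initial condition $(x(0),\dot x(0))\in\mathcal{U}$, with $x_*'\in\mathcal{S}$ the limit of $x(t)$, $$\|x(t)-x_*'\|\le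 C_\varepsilon\big(\|x(0)-x_*'\|+\|\dot x(0)\|\big)e^{-(\sqrt{\mu}-\varepsilon)t}\quad\text{for all } t\ge0.$$
   Context: $\|\cdot\|$ is the Euclidean norm. Local PL condition: a $C^2$ function $f$ satisfies the local PL condition at a local minimizer $x_*$ if there exist an open neighborhood $V$ of $x_*$ and a constant $\nu>0$ such that $\|\nabla f(x)\|^2\ge 2\nu\,(f(x)-f(x_* ))$ for all $x\in V$. Standing assumption: the trivial case in which $f$ is constant in a neighborhood of $x_*$ is excluded. Equivalently, the set $\mathcal{S}$, which under the local PL condition is near $x_*$ a $C^1$ embedded submanifold with tangent space $\ker\nabla^2 f$ at each of its points, has dimension $<d$ near $x_*$. In particular $\nabla^2 f(x_* )$ is positive semidefinite and nonzero, so $\mu>0$. *)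

theory Defs
  imports "HOL-Analysis.Analysis"
begin

definition grad :: "('a::real_inner \<Rightarrow> real) \<Rightarrow> 'a \<Rightarrow> 'a" where
  "grad f x = (THE D. GDERIV f x :> D)"

definition hessian :: "(real ^ 'n \<Rightarrow> real) \<Rightarrow> real ^ 'n \<Rightarrow> real ^ 'n ^ 'n" where
  "hessian f x = jacobian (grad f) (at x)"

definition C2 :: "(real ^ 'n \<Rightarrow> real) \<Rightarrow> bool" where
  "C2 f \<longleftrightarrow> (\<forall>x. f differentiable (at x)) \<and> (\<forall>x. grad f differentiable (at x))
     \<and> continuous_on UNIV (hessian f)"

definition local_minimizer :: "('a::topological_space \<Rightarrow> real) \<Rightarrow> 'a \<Rightarrow> bool" where
  "local_minimizer f x \<longleftrightarrow> (\<exists>V. open V \<and> x \<in> V \<and> (\<forall>y\<in>V. f x \<le> f y))"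

definition local_PL :: "('a::real_inner \<Rightarrow> real) \<Rightarrow> 'a \<Rightarrow> bool" where
  "local_PL f xs \<longleftrightarrow>
     (\<exists>V \<nu>. open V \<and> xs \<in> V \<and> \<nu> > 0 \<and> (\<forall>x\<in>V. (norm (grad f x))\<^sup>2 \<ge> 2 * \<nu> * (f x - f xs)))"

definition minimizer_set :: "('a::topological_space \<Rightarrow> real) \<Rightarrow> 'a \<Rightarrow> 'a set" where
  "minimizer_set f xs = {x. local_minimizer f x \<and> f x = f xs}"

definition eigenvalue :: "real ^ 'n ^ 'n \<Rightarrow> real \<Rightarrow> bool" where
  "eigenvalue A l \<longleftrightarrow> (\<exists>v. v \<noteq> 0 \<and> A *v v = l *\<^sub>R v)"

(* The set has at most CARD('n) elements. Min is unspecified if it is empty, which for the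
   symmetric Hessian of a C2 function happens exactly when the Hessian is zero. *)
definition smallest_nonzero_eigenvalue :: "real ^ 'n ^ 'n \<Rightarrow> real" where
  "smallest_nonzero_eigenvalue A = Min {l. eigenvalue A l \<and> l \<noteq> 0}"

(* x'' + \<gamma> x' + grad f (x) = 0 on [0, \<infinity>), with v = x' and a = x''; derivatives at time 0 are one-sided.
   Values of x and v at negative times are irrelevant. *)
definition heavy_ball :: "(real ^ 'n \<Rightarrow> real) \<Rightarrow> real \<Rightarrow> (real \<Rightarrow> real ^ 'n) \<Rightarrow> (real \<Rightarrow> real ^ 'n) \<Rightarrow> bool" where
  "heavy_ball f \<gamma> x v \<longleftrightarrow>
     (\<forall>t\<ge>0. (x has_vector_derivative v t) (at t within {0..}) \<and>
            (\<exists>a. (v has_vector_derivative a) (at t within {0..}) \<and>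
                 a + \<gamma> *\<^sub>R v t + grad f (x t) = 0))"

definition rate :: "real \<Rightarrow> real \<Rightarrow> real" where
  "rate \<mu> \<gamma> = (\<gamma> - sqrt (max 0 (\<gamma>\<^sup>2 - 4 * \<mu>))) / 2"

lemma grad_eq: "GDERIV f x :> D \<Longrightarrow> grad f x = D"
  unfolding grad_def
proof (rule the_equality)
  fix E assume "GDERIV f x :> D" "GDERIV f x :> E"
  then have "(\<lambda>h. h \<bullet> E) = (\<lambda>h. h \<bullet> D)"
    unfolding gderiv_def by (rule has_derivative_unique[rotated])
  then show "E = D" by (metis vector_eq_ldot)
qed

lemma GDERIV_grad:
  fixes f :: "'a::euclidean_space \<Rightarrow> real"
  assumes "f differentiable (at x)"
  shows "GDERIV f x :> grad f x"
proof -
  obtain F where F: "(f has_derivative F) (at x)"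
    using assms unfolding differentiable_def by blast
  then have "F = (\<lambda>h. h \<bullet> adjoint F 1)"
    using adjoint_works[OF has_derivative_linear[OF F], of _ 1] by auto
  with F have "GDERIV f x :> adjoint F 1" unfolding gderiv_def by metis
  then show ?thesis using grad_eq by metis
qed

lemma C2_iff:
  "C2 f \<longleftrightarrow> (\<exists>g H. (\<forall>x. GDERIV f x :> g x) \<and> (\<forall>x. (g has_derivative (\<lambda>h. H x *v h)) (at x))
     \<and> continuous_on UNIV H)"
proof
  assume "C2 f"
  then show "\<exists>g H. (\<forall>x. GDERIV f x :> g x) \<and> (\<forall>x. (g has_derivative (\<lambda>h. H x *v h)) (at x))
     \<and> continuous_on UNIV H"
    unfolding C2_def hessian_def
    by (intro exI[of _ "grad f"] exI[of _ "\<lambda>x. jacobian (grad f) (at x)"])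
      (auto intro: GDERIV_grad simp flip: jacobian_works simp: hessian_def[abs_def])
next
  assume "\<exists>g H. (\<forall>x. GDERIV f x :> g x) \<and> (\<forall>x. (g has_derivative (\<lambda>h. H x *v h)) (at x))
     \<and> continuous_on UNIV H"
  then obtain g H where g: "\<And>x. GDERIV f x :> g x"
    and H: "\<And>x. (g has_derivative (\<lambda>h. H x *v h)) (at x)" and c: "continuous_on UNIV H" by blast
  have gr: "grad f = g" using grad_eq[OF g] by blast
  have "hessian f x = H x" for x
    unfolding hessian_def jacobian_def gr frechet_derivative_at[OF H, symmetric]
    by simp
  then have "hessian f = H" by blast
  then show "C2 f" unfolding C2_def gr
    using g H c unfolding gderiv_def differentiable_def by blast
qed

end

theory Submission
  imports Defs
begin

text \<open>
  Near a minimizer satisfying the PL inequality the set of minimizers is a manifold, and the sharp rate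
  could be read off from the dynamics transverse to it. The proof below avoids this geometry. It
  never decomposes the trajectory relative to the set of minimizers, but linearizes at the limit point of
  the trajectory itself, with the Hessian frozen at \<open>xs\<close>. The argument has two stages.

  The first stage is a priori convergence. The energy \<open>f - f xs + (norm v)\<^sup>2 / 2\<close> plus a small multiple
  of \<open>grad f \<bullet> v\<close> decays exponentially under the PL inequality, so trajectories that start near
  \<open>(xs, 0)\<close> stay near \<open>xs\<close> and converge exponentially to a minimizer, at some rate \<open>c\<close> that depends
  on crude constants only (\<open>PL_flow_converges_near_minimizer\<close>). Applied to the gradient composed with
  the projection onto a small ball, the same estimate yields existence of trajectories.

  The second stage makes the rate sharp (\<open>sharp_rate_of_perturbed_flow\<close>). Relative to its limit,
  the trajectory solves \<open>z'' + \<gamma> z' + H z = r\<close> with \<open>H\<close> the Hessian at \<open>xs\<close> and \<open>r\<close> bounded by a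
  small multiple of \<open>norm z\<close>. On the orthogonal complement of the kernel of \<open>H\<close>, the
  quadratic form of \<open>H\<close> is at least \<open>\<mu>\<close>, and a shifted energy decays at any rate \<open>a < rate \<mu> \<gamma>\<close>. On the
  kernel there is no restoring force, and the perturbation could a priori produce a slow drift. A drift
  that dominates the contracting part can only decay very slowly, in contradiction to the first stage
  (\<open>cone_argument\<close>). So the contracting part dominates, and the whole trajectory inherits its rate.
  All constants are chosen before the trajectory, which gives the bound by the initial distance
  from the limit and the initial speed.

  That \<open>\<mu>\<close> is positive and is a coercivity constant follows from a Rayleigh quotient argument
  (\<open>rayleigh_minimum_on_kernel_complement\<close>), once the Hessian is known to be symmetric, positive
  semidefinite and nonzero; a vanishing Hessian would force \<open>f\<close> to be constant near \<open>xs\<close>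
  (\<open>hessian_nonzero_under_PL\<close>).
\<close>

section \<open>Local estimates for a twice differentiable function\<close>

text \<open>
  Near \<open>xs\<close> the map \<open>g - A xs\<close> has a small derivative, and the mean value inequality on the
  convex ball turns this into a Lipschitz bound between two arbitrary points. It matters that \<open>y\<close> is
  free while the matrix is frozen at \<open>xs\<close>: the estimate is applied with \<open>y\<close> the limit of a trajectory,
  so that one matrix serves all trajectories.
\<close>
lemma gradient_linearization:
  fixes g :: "'a::euclidean_space \<Rightarrow> 'a"
  assumes der: "\<And>x. (g has_derivative A x) (at x)"
    and cont: "\<And>e. e > 0 \<Longrightarrow> \<exists>r>0. \<forall>y. dist y xs < r \<longrightarrow> (\<forall>h. norm (A y h - A xs h) \<le> e * norm h)"
    and "e > 0"
  shows "\<exists>r>0. \<forall>x\<in>cball xs r. \<forall>y\<in>cball xs r.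
           norm (g x - g y - A xs (x - y)) \<le> e * norm (x - y)"
proof -
  have lin: "bounded_linear (A xs)"
    using der has_derivative_bounded_linear by blast
  obtain r where "r > 0" and r: "\<And>y h. dist y xs < r \<Longrightarrow> norm (A y h - A xs h) \<le> e * norm h"
    using cont[OF \<open>e > 0\<close>] by blast
  have "norm (g x - g y - A xs (x - y)) \<le> e * norm (x - y)"
    if "x \<in> cball xs (r/2)" "y \<in> cball xs (r/2)" for x y
  proof -
    have "norm ((\<lambda>x. g x - A xs x) x - (\<lambda>x. g x - A xs x) y) \<le> e * norm (x - y)"
    proof (rule differentiable_bound[OF convex_cball _ _ that])
      fix z assume z: "z \<in> cball xs (r/2)"
      show "((\<lambda>x. g x - A xs x) has_derivative (\<lambda>h. A z h - A xs h)) (at z within cball xs (r/2))"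
        by (intro has_derivative_diff has_derivative_at_withinI[OF der] bounded_linear_imp_has_derivative lin)
      show "onorm (\<lambda>h. A z h - A xs h) \<le> e"
        using z \<open>r > 0\<close> \<open>e > 0\<close> by (intro onorm_bound r) (auto simp: dist_commute)
    qed
    then show ?thesis
      by (simp add: linear_diff[OF bounded_linear.linear[OF lin]] algebra_simps)
  qed
  then show ?thesis
    using \<open>r > 0\<close> by (intro exI[of _ "r/2"]) auto
qed

text \<open>
  The derivative of the Taylor remainder along the segment from \<open>y\<close> to \<open>x\<close> is the linearization
  error of the gradient, so the mean value theorem suffices. A factor 1/2 in the error is given away.
\<close>
lemma quadratic_approximation:
  fixes f :: "'a::euclidean_space \<Rightarrow> real"
  assumes der: "\<And>x. GDERIV f x :> g x" and "linear H" and "convex S" and "0 \<le> e"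
    and approx: "\<And>x y. x \<in> S \<Longrightarrow> y \<in> S \<Longrightarrow> norm (g x - g y - H (x - y)) \<le> e * norm (x - y)"
    and "x \<in> S" "y \<in> S"
  shows "\<bar>f x - f y - g y \<bullet> (x - y) - (H (x - y) \<bullet> (x - y)) / 2\<bar> \<le> e * (norm (x - y))\<^sup>2"
proof -
  define d where "d = x - y"
  define \<phi> where "\<phi> = (\<lambda>t. f (y + t *\<^sub>R d) - t * (g y \<bullet> d) - t\<^sup>2 * (H d \<bullet> d) / 2)"
  have line: "y + t *\<^sub>R d \<in> S" if "t \<in> {0..1}" for t
    using convexD[OF \<open>convex S\<close> \<open>y \<in> S\<close> \<open>x \<in> S\<close>, of "1 - t" t] that
    by (simp add: d_def algebra_simps)
  have "(\<phi> has_derivative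
      (\<lambda>h. h * ((g (y + t *\<^sub>R d) - g y - H (t *\<^sub>R d)) \<bullet> d))) (at t within {0..1})" for t
  proof -
    have "((\<lambda>t. f (y + t *\<^sub>R d)) has_derivative (\<lambda>h. (h *\<^sub>R d) \<bullet> g (y + t *\<^sub>R d))) (at t within {0..1})"
      using der[of "y + t *\<^sub>R d"] unfolding gderiv_def
      by (rule has_derivative_compose[rotated]) (auto intro!: derivative_eq_intros)
    then show ?thesis
      unfolding \<phi>_def
      by (auto intro!: derivative_eq_intros simp: linear_scale[OF \<open>linear H\<close>] algebra_simps inner_commute)
  qed
  from mvt_very_simple[OF zero_le_one this] obtain t where t: "t \<in> {0..1}"
    and eq: "\<phi> 1 - \<phi> 0 = (1 - 0) * ((g (y + t *\<^sub>R d) - g y - H (t *\<^sub>R d)) \<bullet> d)"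
    by blast
  have "\<bar>\<phi> 1 - \<phi> 0\<bar> \<le> norm (g (y + t *\<^sub>R d) - g y - H (t *\<^sub>R d)) * norm d"
    unfolding eq using Cauchy_Schwarz_ineq2 by simp
  also have "\<dots> \<le> (e * norm (t *\<^sub>R d)) * norm d"
    using approx[OF line[OF t] \<open>y \<in> S\<close>] by (intro mult_right_mono) auto
  also have "\<dots> \<le> e * norm d * norm d"
    using t \<open>0 \<le> e\<close> by (intro mult_right_mono mult_left_mono) (auto intro: mult_left_le_one_le)
  finally show ?thesis
    by (simp add: \<phi>_def d_def power2_eq_square algebra_simps)
qed

text \<open>
  The increment from \<open>xs\<close> to \<open>xs + s h + s k\<close> is expanded along two paths, first \<open>h\<close> then \<open>k\<close> and
  conversely. The expansions agree except for the mixed terms \<open>H h \<bullet> k\<close> and \<open>H k \<bullet> h\<close>, which are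
  therefore equal up to \<open>o(s\<^sup>2)\<close> after multiplication by \<open>s\<^sup>2\<close>.
\<close>
lemma hessian_symmetric:
  fixes f :: "'a::euclidean_space \<Rightarrow> real"
  assumes der: "\<And>x. GDERIV f x :> g x" and "linear H"
    and approx: "\<And>e. e > 0 \<Longrightarrow> \<exists>r>0. \<forall>x\<in>cball xs r. \<forall>y\<in>cball xs r.
           norm (g x - g y - H (x - y)) \<le> e * norm (x - y)"
  shows "H h \<bullet> k = H k \<bullet> h"
proof -
  interpret H: linear H by fact
  define N where "N = (norm h)\<^sup>2 + norm h * norm k + (norm k)\<^sup>2"
  have small: "\<bar>H h \<bullet> k - H k \<bullet> h\<bar> \<le> 2 * N * e" if e: "e > 0" for e
  proof -
    obtain r where "r > 0" and r: "\<And>x y. x \<in> cball xs r \<Longrightarrow> y \<in> cball xs r \<Longrightarrow>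
           norm (g x - g y - H (x - y)) \<le> e * norm (x - y)"
      using approx[OF e] by blast
    \<comment> \<open>The scale at which both paths stay in the ball where the linearization is valid.\<close>
    define s where "s = r / (norm h + norm k + 1)"
    have "s > 0" using \<open>r > 0\<close> by (auto simp: s_def add_nonneg_pos)
    have "s * (norm h + norm k + 1) = r"
      by (simp add: s_def add_nonneg_pos less_imp_neq[symmetric])
    then have sr: "s * norm h + s * norm k \<le> r"
      using \<open>s > 0\<close> by (simp add: algebra_simps)
    have sn: "s * norm h \<ge> 0" "s * norm k \<ge> 0" using \<open>s > 0\<close> by auto
    have two_step: "\<bar>f (xs + s *\<^sub>R a + s *\<^sub>R b) - f xs - s * (g xs \<bullet> a) - s * (g xs \<bullet> b)
        - s\<^sup>2 * (H a \<bullet> b) - s\<^sup>2 * (H a \<bullet> a) / 2 - s\<^sup>2 * (H b \<bullet> b) / 2\<bar>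
        \<le> e * s\<^sup>2 * ((norm a)\<^sup>2 + norm a * norm b + (norm b)\<^sup>2)"
      if ab: "s * norm a + s * norm b \<le> r" for a b
    proof -
      have sab: "s * norm a \<ge> 0" "s * norm b \<ge> 0" using \<open>s > 0\<close> by auto
      have sa: "s * norm a \<le> r" using ab sab by linarith
      have in0: "xs \<in> cball xs r" and in1: "xs + s *\<^sub>R a \<in> cball xs r"
        and in2: "xs + s *\<^sub>R a + s *\<^sub>R b \<in> cball xs r"
        using \<open>r > 0\<close> ab sa \<open>s > 0\<close> norm_triangle_ineq[of "s *\<^sub>R a" "s *\<^sub>R b"]
        by (auto simp: dist_norm norm_minus_commute add.commute add.left_commute)
      have q1: "\<bar>f (xs + s *\<^sub>R a) - f xs - s * (g xs \<bullet> a) - s\<^sup>2 * (H a \<bullet> a) / 2\<bar> \<le> e * s\<^sup>2 * (norm a)\<^sup>2"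
        using quadratic_approximation[OF der \<open>linear H\<close> convex_cball less_imp_le[OF e] r in1 in0]
        by (simp add: H.scale power_mult_distrib power2_eq_square algebra_simps)
      have q2: "\<bar>f (xs + s *\<^sub>R a + s *\<^sub>R b) - f (xs + s *\<^sub>R a) - s * (g (xs + s *\<^sub>R a) \<bullet> b) - s\<^sup>2 * (H b \<bullet> b) / 2\<bar>
          \<le> e * s\<^sup>2 * (norm b)\<^sup>2"
        using quadratic_approximation[OF der \<open>linear H\<close> convex_cball less_imp_le[OF e] r in2 in1]
        by (simp add: H.scale power_mult_distrib power2_eq_square algebra_simps)
      have "\<bar>s * ((g (xs + s *\<^sub>R a) - g xs - H (s *\<^sub>R a)) \<bullet> b)\<bar>
          \<le> s * (norm (g (xs + s *\<^sub>R a) - g xs - H (s *\<^sub>R a)) * norm b)"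
        using \<open>s > 0\<close> Cauchy_Schwarz_ineq2 by (simp add: abs_mult)
      also have "\<dots> \<le> s * ((e * (s * norm a)) * norm b)"
        using r[OF in1 in0] \<open>s > 0\<close> by (intro mult_left_mono mult_right_mono) auto
      finally have q3: "\<bar>s * (g (xs + s *\<^sub>R a) \<bullet> b) - s * (g xs \<bullet> b) - s\<^sup>2 * (H a \<bullet> b)\<bar>
          \<le> e * s\<^sup>2 * (norm a * norm b)"
        by (simp add: H.scale power2_eq_square algebra_simps)
      show ?thesis
        using q1 q2 q3 by (simp add: distrib_left)
    qed
    have "\<bar>s\<^sup>2 * (H h \<bullet> k) - s\<^sup>2 * (H k \<bullet> h)\<bar> \<le> 2 * (e * s\<^sup>2 * N)"
    proof -
      have swap: "xs + s *\<^sub>R k + s *\<^sub>R h = xs + s *\<^sub>R h + s *\<^sub>R k" by simp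
      have N: "(norm k)\<^sup>2 + norm k * norm h + (norm h)\<^sup>2 = N" by (simp add: N_def)
      have kh: "s * norm k + s * norm h \<le> r" using sr by simp
      show ?thesis
        using two_step[OF sr] two_step[OF kh] unfolding swap N N_def[symmetric] by linarith
    qed
    also have "s\<^sup>2 * (H h \<bullet> k) - s\<^sup>2 * (H k \<bullet> h) = s\<^sup>2 * (H h \<bullet> k - H k \<bullet> h)"
      by (simp add: right_diff_distrib)
    finally have "s\<^sup>2 * \<bar>H h \<bullet> k - H k \<bullet> h\<bar> \<le> s\<^sup>2 * (2 * N * e)"
      by (simp add: abs_mult mult_ac)
    then show ?thesis
      using \<open>s > 0\<close> by simp
  qed
  have "N \<ge> 0" by (auto simp: N_def)
  have "\<bar>H h \<bullet> k - H k \<bullet> h\<bar> \<le> e" if "e > 0" for e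
  proof -
    have "\<bar>H h \<bullet> k - H k \<bullet> h\<bar> \<le> 2 * N * (e / (2 * N + 1))"
      using \<open>N \<ge> 0\<close> that by (intro small) (auto intro!: divide_pos_pos)
    also have "\<dots> \<le> e" using \<open>N \<ge> 0\<close> that by (simp add: field_simps)
    finally show ?thesis .
  qed
  then have "\<bar>H h \<bullet> k - H k \<bullet> h\<bar> \<le> 0"
    by (rule field_le_epsilon) simp
  then show ?thesis by simp
qed

lemma gradient_zero_at_local_min:
  fixes f :: "'a::euclidean_space \<Rightarrow> real"
  assumes der: "GDERIV f x :> G" and "open V" "x \<in> V" and "\<And>y. y \<in> V \<Longrightarrow> f x \<le> f y"
  shows "G = 0"
proof -
  have "(\<lambda>h. h \<bullet> G) = (\<lambda>h. 0)"
    using der unfolding gderiv_def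
    by (rule has_derivative_local_min) (use assms in \<open>unfold eventually_at_topological, blast\<close>)
  from fun_cong[OF this, of G] show ?thesis by simp
qed

lemma hessian_psd_at_local_min:
  fixes f :: "'a::euclidean_space \<Rightarrow> real"
  assumes der: "\<And>x. GDERIV f x :> g x" and "linear H"
    and approx: "\<And>e. e > 0 \<Longrightarrow> \<exists>r>0. \<forall>x\<in>cball xs r. \<forall>y\<in>cball xs r.
           norm (g x - g y - H (x - y)) \<le> e * norm (x - y)"
    and "r0 > 0" and lmin: "\<And>y. y \<in> cball xs r0 \<Longrightarrow> f xs \<le> f y" and "g xs = 0"
  shows "0 \<le> H h \<bullet> h"
proof (rule ccontr)
  interpret H: linear H by fact
  assume neg: "\<not> 0 \<le> H h \<bullet> h"
  then have "h \<noteq> 0" by auto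
  \<comment> \<open>Half of the negative quadratic term survives this error.\<close>
  define e where "e = - (H h \<bullet> h) / (4 * (norm h)\<^sup>2)"
  have "e > 0" using neg \<open>h \<noteq> 0\<close> by (auto simp: e_def field_simps)
  obtain r where "r > 0" and r: "\<And>x y. x \<in> cball xs r \<Longrightarrow> y \<in> cball xs r \<Longrightarrow>
           norm (g x - g y - H (x - y)) \<le> e * norm (x - y)"
    using approx[OF \<open>e > 0\<close>] by blast
  define s where "s = min r r0 / norm h"
  have "s > 0" "s * norm h \<le> r" "s * norm h \<le> r0"
    using \<open>r > 0\<close> \<open>r0 > 0\<close> \<open>h \<noteq> 0\<close> by (auto simp: s_def)
  then have in1: "xs + s *\<^sub>R h \<in> cball xs r" "xs \<in> cball xs r" and "xs + s *\<^sub>R h \<in> cball xs r0"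
    using \<open>r > 0\<close> by (auto simp: dist_norm)
  have "\<bar>f (xs + s *\<^sub>R h) - f xs - s\<^sup>2 * (H h \<bullet> h) / 2\<bar> \<le> e * (s\<^sup>2 * (norm h)\<^sup>2)"
    using quadratic_approximation[OF der \<open>linear H\<close> convex_cball less_imp_le[OF \<open>e > 0\<close>] r in1] \<open>g xs = 0\<close>
    by (simp add: H.scale power_mult_distrib power2_eq_square algebra_simps)
  moreover have "e * (s\<^sup>2 * (norm h)\<^sup>2) = - s\<^sup>2 * (H h \<bullet> h) / 4"
    using \<open>h \<noteq> 0\<close> by (simp add: e_def field_simps)
  moreover have "s\<^sup>2 * (H h \<bullet> h) < 0" using neg \<open>s > 0\<close> by (simp add: mult_pos_neg)
  ultimately show False
    using lmin[OF \<open>xs + s *\<^sub>R h \<in> cball xs r0\<close>] by (simp add: abs_le_iff)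
qed

text \<open>
  A gradient step of length \<open>1 / L\<close>, with \<open>L = B + 2 e\<close>, decreases \<open>f\<close> by at least
  \<open>(norm (g x))\<^sup>2 / (2 L)\<close>, and it cannot go below the local minimum. The factor 2 between the
  radii leaves room for the step, since its length is at most \<open>norm (x - xs)\<close>.
\<close>
lemma gradient_squared_le_gap:
  fixes f :: "'a::euclidean_space \<Rightarrow> real"
  assumes der: "\<And>x. GDERIV f x :> g x" and "linear H" and "e > 0" "B \<ge> 0"
    and B: "\<And>h. norm (H h) \<le> B * norm h"
    and approx: "\<And>x y. x \<in> cball xs r \<Longrightarrow> y \<in> cball xs r \<Longrightarrow>
           norm (g x - g y - H (x - y)) \<le> e * norm (x - y)"
    and lmin: "\<And>y. y \<in> cball xs r \<Longrightarrow> f xs \<le> f y" and "g xs = 0"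
    and x: "x \<in> cball xs (r / 2)"
  shows "(norm (g x))\<^sup>2 \<le> 2 * (B + 2 * e) * (f x - f xs)"
    and "norm (g x) \<le> (B + 2 * e) * norm (x - xs)"
proof -
  define L where "L = B + 2 * e"
  have "L > 0" using assms by (auto simp: L_def)
  have "r \<ge> 0" using x by (metis divide_less_0_iff mem_cball not_le order_trans zero_le_dist zero_less_numeral)
  have xin: "x \<in> cball xs r" and xsin: "xs \<in> cball xs r"
    using x \<open>r \<ge> 0\<close> by auto
  have "norm (g x) \<le> norm (g x - g xs - H (x - xs)) + norm (H (x - xs))"
    using norm_triangle_ineq[of "g x - g xs - H (x - xs)" "H (x - xs)"] \<open>g xs = 0\<close> by simp
  also have "\<dots> \<le> e * norm (x - xs) + B * norm (x - xs)"
    using approx[OF xin xsin] B by (intro add_mono)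
  also have "\<dots> \<le> L * norm (x - xs)"
    using \<open>e > 0\<close> by (simp add: L_def algebra_simps)
  finally show gL: "norm (g x) \<le> (B + 2 * e) * norm (x - xs)" by (simp add: L_def)
  define d where "d = - (1 / L) *\<^sub>R g x"
  have "norm d \<le> norm (x - xs)"
    using gL \<open>L > 0\<close> unfolding L_def[symmetric] by (simp add: d_def field_simps)
  then have "x + d \<in> cball xs r"
    using x norm_triangle_ineq[of "x - xs" d] by (simp add: dist_norm norm_minus_commute algebra_simps)
  note q = quadratic_approximation[OF der \<open>linear H\<close> convex_cball less_imp_le[OF \<open>e > 0\<close>] approx this xin]
  have "H d \<bullet> d \<le> norm (H d) * norm d" by (rule norm_cauchy_schwarz)
  also have "\<dots> \<le> (B * norm d) * norm d" by (intro mult_right_mono B) auto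
  finally have "H d \<bullet> d \<le> B * (norm d)\<^sup>2" by (simp add: power2_eq_square)
  then have "f (x + d) \<le> f x + g x \<bullet> d + L / 2 * (norm d)\<^sup>2"
    using q by (simp add: L_def abs_le_iff add_divide_distrib distrib_right)
  also have "g x \<bullet> d = - (norm (g x))\<^sup>2 / L"
    by (simp add: d_def power2_norm_eq_inner)
  also have "L / 2 * (norm d)\<^sup>2 = (norm (g x))\<^sup>2 / (2 * L)"
    using \<open>L > 0\<close> by (simp add: d_def power2_eq_square field_simps)
  finally have "f (x + d) \<le> f x - (norm (g x))\<^sup>2 / (2 * L)"
    using \<open>L > 0\<close> by (simp add: field_simps)
  with lmin[OF \<open>x + d \<in> cball xs r\<close>] have "(norm (g x))\<^sup>2 / (2 * L) \<le> f x - f xs" by simp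
  then show "(norm (g x))\<^sup>2 \<le> 2 * (B + 2 * e) * (f x - f xs)"
    using \<open>L > 0\<close> unfolding L_def[symmetric] by (simp add: field_simps)
qed

text \<open>
  If the Hessian vanished, the previous lemma would hold with an arbitrarily small constant,
  so the squared gradient would be at most half of what the PL inequality requires. This forces
  \<open>f = f xs\<close> near \<open>xs\<close>.
\<close>
lemma hessian_nonzero_under_PL:
  fixes f :: "'a::euclidean_space \<Rightarrow> real"
  assumes der: "\<And>x. GDERIV f x :> g x"
    and approx: "\<And>e. e > 0 \<Longrightarrow> \<exists>r>0. \<forall>x\<in>cball xs r. \<forall>y\<in>cball xs r.
           norm (g x - g y - H (x - y)) \<le> e * norm (x - y)"
    and "r0 > 0" and lmin: "\<And>y. y \<in> cball xs r0 \<Longrightarrow> f xs \<le> f y" and "g xs = 0"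
    and "\<nu> > 0" and PL: "\<And>y. y \<in> cball xs r0 \<Longrightarrow> 2 * \<nu> * (f y - f xs) \<le> (norm (g y))\<^sup>2"
    and nonconst: "\<not> (\<exists>V. open V \<and> xs \<in> V \<and> f constant_on V)"
  shows "\<exists>h. H h \<noteq> 0"
proof (rule ccontr)
  assume "\<not> (\<exists>h. H h \<noteq> 0)"
  then have H0: "H = (\<lambda>h. 0)" by auto
  \<comment> \<open>This makes the constant \<open>4 e\<close> of the upper bound smaller than the PL constant \<open>2 \<nu>\<close>.\<close>
  define e where "e = \<nu> / 4"
  have "e > 0" using \<open>\<nu> > 0\<close> by (simp add: e_def)
  obtain r where "r > 0" and r: "\<And>x y. x \<in> cball xs r \<Longrightarrow> y \<in> cball xs r \<Longrightarrow>
           norm (g x - g y - H (x - y)) \<le> e * norm (x - y)"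
    using approx[OF \<open>e > 0\<close>] by blast
  define s where "s = min r r0"
  have "f y = f xs" if y: "y \<in> ball xs (s / 2)" for y
  proof -
    have "(norm (g y))\<^sup>2 \<le> 2 * (0 + 2 * e) * (f y - f xs)"
    proof (rule gradient_squared_le_gap(1)[OF der, of H])
      show "linear H" unfolding H0 by (rule linear_zero)
      show "y \<in> cball xs (s / 2)" using y by auto
    qed (use \<open>e > 0\<close> H0 r lmin \<open>g xs = 0\<close> in \<open>auto simp: s_def\<close>)
    moreover have "0 < s" using \<open>r > 0\<close> \<open>r0 > 0\<close> by (simp add: s_def)
    then have "y \<in> cball xs r0" using y unfolding s_def mem_ball mem_cball by linarith
    moreover from this have "f y - f xs \<ge> 0" using lmin by simp
    ultimately have "2 * \<nu> * (f y - f xs) \<le> \<nu> * (f y - f xs)"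
      using PL[of y] by (simp add: e_def)
    then have "\<nu> * (f y - f xs) \<le> 0" by linarith
    with \<open>f y - f xs \<ge> 0\<close> \<open>\<nu> > 0\<close> show ?thesis by (simp add: mult_le_0_iff)
  qed
  moreover have "0 < s" using \<open>r > 0\<close> \<open>r0 > 0\<close> by (simp add: s_def)
  ultimately have "f constant_on ball xs (s / 2)" "xs \<in> ball xs (s / 2)"
    unfolding constant_on_def by (blast, simp)
  then have "open (ball xs (s / 2)) \<and> xs \<in> ball xs (s / 2) \<and> f constant_on ball xs (s / 2)"
    using open_ball by blast
  then have "\<exists>V. open V \<and> xs \<in> V \<and> f constant_on V" by (rule exI)
  with nonconst show False by (rule notE)
qed

section \<open>Spectral facts for symmetric linear maps\<close>

lemma orthogonal_projection_exists:
  fixes K :: "'a::euclidean_space set"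
  assumes "subspace K"
  obtains Q where "linear Q" "\<And>x. Q x \<in> K" "\<And>x k. k \<in> K \<Longrightarrow> (x - Q x) \<bullet> k = 0"
proof -
  obtain B where "B \<subseteq> K" and orth: "pairwise orthogonal B" and one: "\<And>x. x \<in> B \<Longrightarrow> norm x = 1"
    and ind: "independent B" and "span B = K"
    using orthonormal_basis_subspace[OF assms] by metis
  have "finite B" using ind by (rule independent_imp_finite)
  define Q where "Q = (\<lambda>z. \<Sum>b\<in>B. (z \<bullet> b) *\<^sub>R b)"
  show thesis
  proof
    show "linear Q"
      unfolding Q_def
      by (rule linearI) (simp_all add: inner_add_left scaleR_add_left sum.distrib scaleR_sum_right)
    show "Q x \<in> K" for x
      unfolding Q_def using \<open>B \<subseteq> K\<close> assms by (intro subspace_sum subspace_scale) auto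
    fix x k assume "k \<in> K"
    have "orthogonal (x - Q x) b" if "b \<in> B" for b
    proof -
      have "Q x \<bullet> b = (\<Sum>c\<in>B. if c = b then x \<bullet> b else 0)"
        unfolding Q_def inner_sum_left
      proof (rule sum.cong[OF refl])
        fix c assume "c \<in> B"
        then show "((x \<bullet> c) *\<^sub>R c) \<bullet> b = (if c = b then x \<bullet> b else 0)"
          using orth that one[OF that]
          by (auto simp: pairwise_def orthogonal_def norm_eq_1)
      qed
      then show ?thesis
        using \<open>finite B\<close> that by (simp add: orthogonal_def inner_diff_left)
    qed
    then have "orthogonal (x - Q x) k"
      using \<open>k \<in> K\<close> \<open>span B = K\<close> orthogonal_to_span by blast
    then show "(x - Q x) \<bullet> k = 0" by (simp add: orthogonal_def)
  qed
qed

text \<open>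
  Orthogonality of range and kernel is where symmetry enters; it makes the projection \<open>Q\<close> annihilate
  \<open>H\<close> on both sides, and hence splits a linear second order equation with matrix \<open>H\<close> into a part
  on the kernel without restoring force and a part on its complement.
\<close>
lemma kernel_projection_exists:
  fixes H :: "'a::euclidean_space \<Rightarrow> 'a"
  assumes "linear H" and sym: "\<And>x y. H x \<bullet> y = H y \<bullet> x"
  obtains Q where "linear Q" "\<And>x. H (Q x) = 0" "\<And>x. Q (H x) = 0"
    "\<And>x k. H k = 0 \<Longrightarrow> (x - Q x) \<bullet> k = 0" "\<And>x. norm (Q x) \<le> norm x"
    "\<And>x. norm (x - Q x) \<le> norm x"
proof -
  have sub: "subspace {x. H x = 0}"
    using \<open>linear H\<close> by (rule linear_subspace_kernel)
  obtain Q where lin: "linear Q" and ker: "\<And>x. Q x \<in> {x. H x = 0}"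
    and orth: "\<And>x k. k \<in> {x. H x = 0} \<Longrightarrow> (x - Q x) \<bullet> k = 0"
    by (rule orthogonal_projection_exists[OF sub], rule that)
  have self: "Q x \<bullet> Q x = x \<bullet> Q x" for x
    using orth[OF ker, of x x] by (simp add: inner_diff_left)
  show thesis
  proof (rule that[OF lin])
    show HQ: "H (Q x) = 0" for x using ker by simp
    show QH: "Q (H x) = 0" for x
    proof -
      have "Q (H x) \<bullet> Q (H x) = H (Q (H x)) \<bullet> x"
        unfolding self[of "H x"] by (rule sym)
      then show ?thesis unfolding HQ by simp
    qed
    show "(x - Q x) \<bullet> k = 0" if "H k = 0" for x k using orth that by simp
    have pyth: "(norm x)\<^sup>2 = (norm (Q x))\<^sup>2 + (norm (x - Q x))\<^sup>2" for x
      unfolding power2_norm_eq_inner inner_diff_left inner_diff_right inner_commute[of "Q x" x]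
      using self[of x] by linarith
    show "norm (Q x) \<le> norm x" for x
      by (rule power2_le_imp_le) (simp_all add: pyth[of x])
    show "norm (x - Q x) \<le> norm x" for x
      by (rule power2_le_imp_le) (simp_all add: pyth[of x])
  qed
qed

text \<open>
  Eigenvectors of distinct eigenvalues are orthogonal, so there are at most as many as the dimension.
\<close>
lemma finite_eigenvalues_symmetric:
  fixes H :: "'a::euclidean_space \<Rightarrow> 'a"
  assumes sym: "\<And>x y. H x \<bullet> y = H y \<bullet> x"
  shows "finite {l. \<exists>v. v \<noteq> 0 \<and> H v = l *\<^sub>R v}"
proof -
  define E where "E = {l. \<exists>v. v \<noteq> 0 \<and> H v = l *\<^sub>R v}"
  have "\<forall>l\<in>E. \<exists>v. v \<noteq> 0 \<and> H v = l *\<^sub>R v" by (simp add: E_def)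
  from bchoice[OF this] obtain V where "\<forall>l\<in>E. V l \<noteq> 0 \<and> H (V l) = l *\<^sub>R V l" ..
  then have V: "V l \<noteq> 0" "H (V l) = l *\<^sub>R V l" if "l \<in> E" for l
    using that by auto
  have orth: "V l \<bullet> V m = 0" if "l \<in> E" "m \<in> E" "l \<noteq> m" for l m
  proof -
    have "l * (V l \<bullet> V m) = m * (V l \<bullet> V m)"
      using sym[of "V l" "V m"] unfolding V(2)[OF that(1)] V(2)[OF that(2)]
      by (simp add: inner_commute)
    then show ?thesis using \<open>l \<noteq> m\<close> by simp
  qed
  have "inj_on V E"
  proof (rule inj_onI, rule ccontr)
    fix l m assume "l \<in> E" "m \<in> E" "V l = V m" "l \<noteq> m"
    with orth[of l m] V(1)[of m] show False by simp
  qed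
  moreover have "independent (V ` E)"
  proof (rule pairwise_orthogonal_independent)
    show "pairwise orthogonal (V ` E)"
      unfolding pairwise_def orthogonal_def using orth by blast
    show "0 \<notin> V ` E" using V(1) by force
  qed
  ultimately show ?thesis
    unfolding E_def[symmetric] by (intro finite_imageD[OF independent_imp_finite])
qed

text \<open>
  The Rayleigh quotient attains its minimum \<open>l\<close> over the kernel's orthogonal complement, and the
  minimizer is an eigenvector. This replaces a full diagonalization: all that is required is
  one eigenvalue that is also a coercivity constant.
\<close>
lemma rayleigh_minimum_on_kernel_complement:
  fixes H :: "'a::euclidean_space \<Rightarrow> 'a"
  assumes "linear H" and sym: "\<And>x y. H x \<bullet> y = H y \<bullet> x" and psd: "\<And>x. 0 \<le> H x \<bullet> x"
    and "H h \<noteq> 0"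
  obtains l v where "l > 0" "v \<noteq> 0" "H v = l *\<^sub>R v"
    "\<And>x. (\<And>k. H k = 0 \<Longrightarrow> x \<bullet> k = 0) \<Longrightarrow> l * (norm x)\<^sup>2 \<le> H x \<bullet> x"
proof -
  interpret H: linear H by fact
  define N where "N = {x. \<forall>k. H k = 0 \<longrightarrow> x \<bullet> k = 0}"
  have N: "subspace N"
    unfolding N_def by (auto simp: subspace_def inner_add_left)
  have "closed N"
    using N by (rule closed_subspace)
  obtain Q where Q: "\<And>x. H (Q x) = 0" "\<And>x k. H k = 0 \<Longrightarrow> (x - Q x) \<bullet> k = 0"
    using kernel_projection_exists[OF \<open>linear H\<close> sym] by metis
  have normalize: "x /\<^sub>R norm x \<in> sphere 0 1 \<inter> N" if "x \<in> N" "x \<noteq> 0" for x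
    using that subspace_scale[OF N] by auto
  have "h - Q h \<in> N"
    using Q(2) by (simp add: N_def)
  moreover have "h - Q h \<noteq> 0"
    using Q(1)[of h] \<open>H h \<noteq> 0\<close> by (metis right_minus_eq)
  ultimately have "sphere 0 1 \<inter> N \<noteq> {}" using normalize by blast
  moreover have "compact (sphere 0 1 \<inter> N)"
    using \<open>closed N\<close> by (intro compact_Int_closed) auto
  moreover have "continuous_on (sphere 0 1 \<inter> N) (\<lambda>x. H x \<bullet> x)"
    using \<open>linear H\<close> by (intro continuous_intros linear_continuous_on linear_conv_bounded_linear[THEN iffD1])
  ultimately obtain v where v: "v \<in> sphere 0 1 \<inter> N"
    and vmin: "\<And>y. y \<in> sphere 0 1 \<inter> N \<Longrightarrow> H v \<bullet> v \<le> H y \<bullet> y"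
    using continuous_attains_inf[of "sphere 0 1 \<inter> N" "\<lambda>x. H x \<bullet> x"] by blast
  define l where "l = H v \<bullet> v"
  have bound: "l * (norm x)\<^sup>2 \<le> H x \<bullet> x" if "x \<in> N" for x
  proof (cases "x = 0")
    case False
    then have "l \<le> H (x /\<^sub>R norm x) \<bullet> (x /\<^sub>R norm x)"
      using vmin[OF normalize[OF that False]] by (simp add: l_def)
    also have "\<dots> = (H x \<bullet> x) / (norm x)\<^sup>2"
      by (simp add: H.scale power2_eq_square divide_inverse)
    finally show ?thesis using False by (simp add: field_simps)
  qed (simp add: H.zero)
  \<comment> \<open>The residual is itself an admissible direction; moving against it would lower the quotient unless it vanishes.\<close>
  define y where "y = H v - l *\<^sub>R v"
  have "y \<in> N"
    using v sym by (auto simp: N_def y_def inner_diff_left)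
  have "y = 0"
  proof (rule ccontr)
    assume "y \<noteq> 0"
    define A where "A = (norm y)\<^sup>2"
    define B where "B = \<bar>H y \<bullet> y - l * (norm y)\<^sup>2\<bar>"
    \<comment> \<open>Small enough for the first order gain \<open>2 s A\<close> to beat the second order term \<open>s * s * B\<close>.\<close>
    define s where "s = A / (B + 1)"
    have "A > 0" using \<open>y \<noteq> 0\<close> by (simp add: A_def)
    have "B \<ge> 0" by (simp add: B_def)
    then have "s > 0" using \<open>A > 0\<close> by (simp add: s_def)
    have "s * B \<le> A" using \<open>A > 0\<close> \<open>B \<ge> 0\<close> by (simp add: s_def field_simps)
    have "v - s *\<^sub>R y \<in> N"
      using v \<open>y \<in> N\<close> by (intro subspace_diff[OF N] subspace_scale[OF N]) auto
    from bound[OF this] have "0 \<le> - 2 * s * ((H v - l *\<^sub>R v) \<bullet> y) + s * s * (H y \<bullet> y - l * (norm y)\<^sup>2)"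
      using v sym[of v y] unfolding power2_norm_eq_inner
      by (simp add: l_def H.diff H.scale inner_diff_left inner_diff_right norm_eq_1 inner_commute algebra_simps)
    also have "\<dots> \<le> - 2 * s * A + s * s * B"
    proof -
      have "s * s * (H y \<bullet> y - l * (norm y)\<^sup>2) \<le> s * s * B"
        using \<open>s > 0\<close> by (intro mult_left_mono) (auto simp: B_def)
      moreover have "(H v - l *\<^sub>R v) \<bullet> y = A" by (simp add: y_def A_def power2_norm_eq_inner)
      ultimately show ?thesis by simp
    qed
    also have "\<dots> = s * (s * B - 2 * A)" by (simp add: algebra_simps)
    finally have "0 \<le> s * B - 2 * A" using \<open>s > 0\<close> by (simp add: zero_le_mult_iff)
    with \<open>s * B \<le> A\<close> \<open>A > 0\<close> show False by linarith
  qed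
  then have eig: "H v = l *\<^sub>R v" by (simp add: y_def)
  have "v \<noteq> 0" using v by auto
  moreover have "l \<noteq> 0"
  proof
    assume "l = 0"
    then have "v \<bullet> v = 0" using eig v by (simp add: N_def)
    with \<open>v \<noteq> 0\<close> show False by simp
  qed
  then have "l > 0" using psd[of v] by (simp add: l_def)
  ultimately show thesis
    using that eig bound by (auto simp: N_def)
qed

section \<open>Growth and decay along curves\<close>

text \<open>
  The product \<open>exp (- k t) * E t\<close> is monotone. Derivatives at interior points and
  continuity at the ends are what a flow defined on \<open>{0..}\<close> provides.
\<close>
lemma gronwall_le:
  fixes E :: "real \<Rightarrow> real"
  assumes "a \<le> b" and cont: "continuous_on {a..b} E"
    and der: "\<And>t. a < t \<Longrightarrow> t < b \<Longrightarrow> \<exists>D. (E has_real_derivative D) (at t) \<and> D \<le> k * E t"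
  shows "E b \<le> E a * exp (k * (b - a))"
proof -
  have "exp (- k * a) * E a \<ge> exp (- k * b) * E b"
  proof (rule DERIV_nonpos_imp_decreasing_open[OF \<open>a \<le> b\<close>, of "\<lambda>t. exp (- k * t) * E t"])
    fix t assume "a < t" "t < b"
    from der[OF this] obtain D where D: "(E has_real_derivative D) (at t)" and le: "D \<le> k * E t"
      by blast
    have "((\<lambda>t. exp (- k * t) * E t) has_real_derivative exp (- k * t) * (D - k * E t)) (at t)"
      using D by (auto intro!: derivative_eq_intros simp: algebra_simps)
    moreover have "exp (- k * t) * (D - k * E t) \<le> 0"
      using le by (intro mult_nonneg_nonpos) auto
    ultimately show "\<exists>y. ((\<lambda>t. exp (- k * t) * E t) has_real_derivative y) (at t) \<and> y \<le> 0"
      by blast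
  qed (intro continuous_intros cont)
  then have "exp (k * b) * (exp (- k * b) * E b) \<le> exp (k * b) * (exp (- k * a) * E a)"
    by (intro mult_left_mono) auto
  also have "exp (k * b) * (exp (- k * b) * E b) = E b"
    by (simp add: exp_minus)
  also have "exp (k * b) * (exp (- k * a) * E a) = E a * exp (k * (b - a))"
    by (simp add: exp_minus exp_diff right_diff_distrib divide_inverse)
  finally show ?thesis .
qed

lemma gronwall_ge:
  fixes E :: "real \<Rightarrow> real"
  assumes "a \<le> b" and cont: "continuous_on {a..b} E"
    and der: "\<And>t. a < t \<Longrightarrow> t < b \<Longrightarrow> \<exists>D. (E has_real_derivative D) (at t) \<and> k * E t \<le> D"
  shows "E a * exp (k * (b - a)) \<le> E b"
proof -
  have "- E b \<le> - E a * exp (k * (b - a))"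
  proof (rule gronwall_le[OF \<open>a \<le> b\<close>, of "\<lambda>t. - E t"])
    fix t assume "a < t" "t < b"
    from der[OF this] obtain D where "(E has_real_derivative D) (at t)" "k * E t \<le> D" by blast
    then show "\<exists>D. ((\<lambda>t. - E t) has_real_derivative D) (at t) \<and> D \<le> k * - E t"
      by (intro exI[of _ "- D"]) (auto intro: derivative_intros)
  qed (intro continuous_intros cont)
  then show ?thesis by simp
qed

text \<open>
  The sign of \<open>c\<close> is free: a positive one bounds the length of a curve whose speed decays, a
  negative one controls exponential growth. Keeping the subtracted term makes both cases one lemma.
\<close>
lemma displacement_le:
  fixes x :: "real \<Rightarrow> 'a::real_normed_vector"
  assumes "s \<le> t" and cont: "continuous_on {s..t} x"
    and der: "\<And>r. s < r \<Longrightarrow> r < t \<Longrightarrow> (x has_vector_derivative v r) (at r)"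
    and bound: "\<And>r. s < r \<Longrightarrow> r < t \<Longrightarrow> norm (v r) \<le> c * M * exp (- c * r)"
  shows "norm (x t - x s) \<le> M * exp (- c * s) - M * exp (- c * t)"
proof (cases "s = t")
  case False
  then have "s < t" using \<open>s \<le> t\<close> by simp
  have "norm (x t - x s) \<le> (\<lambda>r. - M * exp (- c * r)) t - (\<lambda>r. - M * exp (- c * r)) s"
  proof (rule differentiable_bound_general[OF \<open>s < t\<close> cont])
    show "continuous_on {s..t} (\<lambda>r. - M * exp (- c * r))" by (intro continuous_intros)
    show "((\<lambda>r. - M * exp (- c * r)) has_vector_derivative c * M * exp (- c * r)) (at r)" for r
      unfolding has_real_derivative_iff_has_vector_derivative[symmetric]
      by (auto intro!: derivative_eq_intros)
  qed (use der bound in auto)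
  then show ?thesis by simp
qed simp

lemma exponentially_cauchy_converges:
  fixes x :: "real \<Rightarrow> 'a::banach"
  assumes "c > 0" and M: "\<And>s t. 0 \<le> s \<Longrightarrow> s \<le> t \<Longrightarrow> norm (x t - x s) \<le> M * exp (- c * s)"
  obtains z where "(x \<longlongrightarrow> z) at_top" "\<And>t. 0 \<le> t \<Longrightarrow> norm (x t - z) \<le> M * exp (- c * t)"
proof -
  have lim0: "((\<lambda>t. M * exp (- c * t)) \<longlongrightarrow> 0) at_top"
  proof (intro tendsto_mult_right_zero filterlim_compose[OF exp_at_bot])
    show "LIM t at_top. - c * t :> at_bot"
      using \<open>c > 0\<close> by (intro filterlim_tendsto_neg_mult_at_bot[OF tendsto_const] filterlim_ident) auto
  qed
  have "Cauchy (\<lambda>n. x (real n))"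
  proof (rule CauchyI')
    fix e :: real assume "e > 0"
    have "\<forall>\<^sub>F t in at_top. M * exp (- c * t) < e"
      using lim0 \<open>e > 0\<close> by (rule order_tendstoD)
    then obtain T where T: "\<And>t. T \<le> t \<Longrightarrow> M * exp (- c * t) < e"
      unfolding eventually_at_top_linorder by blast
    show "\<exists>N. \<forall>m\<ge>N. \<forall>n>m. dist (x (real m)) (x (real n)) < e"
    proof (intro exI[of _ "nat \<lceil>T\<rceil>"] allI impI)
      fix m n assume "nat \<lceil>T\<rceil> \<le> m" "m < n"
      then have "T \<le> real m" by linarith
      moreover have "norm (x (real n) - x (real m)) \<le> M * exp (- c * real m)"
        using \<open>m < n\<close> by (intro M) auto
      ultimately have "norm (x (real n) - x (real m)) < e"
        using T by fastforce
      then show "dist (x (real m)) (x (real n)) < e"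
        by (simp add: dist_norm norm_minus_commute)
    qed
  qed
  then obtain z where z: "(\<lambda>n. x (real n)) \<longlonglongrightarrow> z"
    using Cauchy_convergent_iff convergent_def by blast
  have bound: "norm (x t - z) \<le> M * exp (- c * t)" if "0 \<le> t" for t
  proof (rule tendsto_upperbound)
    show "(\<lambda>n. norm (x t - x (real n))) \<longlonglongrightarrow> norm (x t - z)"
      by (intro tendsto_intros z)
    show "\<forall>\<^sub>F n in sequentially. norm (x t - x (real n)) \<le> M * exp (- c * t)"
    proof (rule eventually_sequentiallyI[of "nat \<lceil>t\<rceil>"])
      fix n assume "nat \<lceil>t\<rceil> \<le> n"
      then have "t \<le> real n" by linarith
      from M[OF that this] show "norm (x t - x (real n)) \<le> M * exp (- c * t)"
        by (simp add: norm_minus_commute)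
    qed
  qed simp
  have "((\<lambda>t. x t - z) \<longlongrightarrow> 0) at_top"
  proof (rule Lim_null_comparison[OF _ lim0])
    show "\<forall>\<^sub>F t in at_top. norm (x t - z) \<le> M * exp (- c * t)"
      using eventually_ge_at_top[of 0] by eventually_elim (rule bound)
  qed
  then have "(x \<longlongrightarrow> z) at_top" by (simp add: LIM_zero_iff)
  with bound show thesis using that by blast
qed

section \<open>Energy decay and convergence under the Polyak-Lojasiewicz inequality\<close>

text \<open>
  The heavy ball equation for an arbitrary force field \<open>G\<close>. This generality is needed because
  solutions are first constructed for a globally Lipschitz field that agrees with the gradient only
  near the minimizer.
\<close>
definition damped_flow :: "('a::real_normed_vector \<Rightarrow> 'a) \<Rightarrow> real \<Rightarrow> (real \<Rightarrow> 'a) \<Rightarrow> (real \<Rightarrow> 'a) \<Rightarrow> bool" where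
  "damped_flow G \<gamma> x v \<longleftrightarrow>
     (\<forall>t\<ge>0. (x has_vector_derivative v t) (at t within {0..}) \<and>
            (v has_vector_derivative (- (\<gamma> *\<^sub>R v t) - G (x t))) (at t within {0..}))"

lemma damped_flow_continuous:
  assumes "damped_flow G \<gamma> x v"
  shows "continuous_on {0..} x" "continuous_on {0..} v"
  using assms unfolding damped_flow_def
  by (auto intro!: continuous_on_vector_derivative)

lemma damped_flow_deriv:
  assumes "damped_flow G \<gamma> x v" "t > 0"
  shows "(x has_vector_derivative v t) (at t)"
    and "(v has_vector_derivative (- (\<gamma> *\<^sub>R v t) - G (x t))) (at t)"
proof -
  have "at t within {0..} = at t"
    using \<open>t > 0\<close> by (intro at_within_interior) (simp add: interior_real_atLeast)
  then show "(x has_vector_derivative v t) (at t)"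
    and "(v has_vector_derivative (- (\<gamma> *\<^sub>R v t) - G (x t))) (at t)"
    using assms by (auto simp: damped_flow_def dest: spec[of _ t])
qed

text \<open>
  In this and the next two lemmas \<open>F\<close> stands for the gap \<open>f x - f xs\<close>, \<open>G\<close> for the gradient, \<open>w\<close> for
  the velocity and \<open>Aw\<close> for the Hessian applied to the velocity. The mechanical energy
  \<open>F + (norm w)\<^sup>2 / 2\<close> alone dissipates only through \<open>w\<close>; the small cross term \<open>\<beta> * (G \<bullet> w)\<close>
  adds dissipation through \<open>G\<close>, which the PL inequality compares with \<open>F\<close>. The smallness conditions
  on \<open>\<beta>\<close> keep the cross term from destroying positivity.
\<close>
lemma energy_lower_bound:
  fixes G w :: "'a::real_inner"
  assumes "0 \<le> \<beta>" "\<beta> \<le> 1/2" "\<beta> * L \<le> 1/2" "0 \<le> F" "(norm G)\<^sup>2 \<le> 2 * L * F"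
  shows "F / 2 + (norm w)\<^sup>2 / 4 \<le> F + (norm w)\<^sup>2 / 2 + \<beta> * (G \<bullet> w)"
proof -
  have "0 \<le> (norm (G + w))\<^sup>2" by simp
  then have "- ((norm G)\<^sup>2 + (norm w)\<^sup>2) / 2 \<le> G \<bullet> w"
    unfolding power2_norm_eq_inner by (simp add: inner_add_left inner_add_right inner_commute)
  then have "\<beta> * (- ((norm G)\<^sup>2 + (norm w)\<^sup>2) / 2) \<le> \<beta> * (G \<bullet> w)"
    using \<open>0 \<le> \<beta>\<close> by (rule mult_left_mono)
  moreover have "\<beta> * (norm G)\<^sup>2 \<le> F"
  proof -
    have "\<beta> * (norm G)\<^sup>2 \<le> \<beta> * (2 * L * F)" using assms by (intro mult_left_mono)
    also have "\<dots> = 2 * (\<beta> * L) * F" by simp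
    also have "\<dots> \<le> 2 * (1/2) * F" using assms by (intro mult_right_mono mult_left_mono) auto
    finally show ?thesis by simp
  qed
  moreover have "\<beta> * (norm w)\<^sup>2 \<le> 1/2 * (norm w)\<^sup>2"
    using assms by (intro mult_right_mono) auto
  ultimately show ?thesis by (simp add: algebra_simps)
qed

lemma energy_upper_bound:
  fixes G w :: "'a::real_inner"
  assumes "0 \<le> \<beta>" "0 < \<nu>" "2 * \<nu> * F \<le> (norm G)\<^sup>2"
  shows "F + (norm w)\<^sup>2 / 2 + \<beta> * (G \<bullet> w)
    \<le> (1 / (2 * \<nu>) + \<beta> / 2) * (norm G)\<^sup>2 + ((1 + \<beta>) / 2) * (norm w)\<^sup>2"
proof -
  have "0 \<le> (norm (G - w))\<^sup>2" by simp
  then have "G \<bullet> w \<le> ((norm G)\<^sup>2 + (norm w)\<^sup>2) / 2"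
    unfolding power2_norm_eq_inner by (simp add: inner_diff_left inner_diff_right inner_commute)
  then have "\<beta> * (G \<bullet> w) \<le> \<beta> * (((norm G)\<^sup>2 + (norm w)\<^sup>2) / 2)"
    using \<open>0 \<le> \<beta>\<close> by (rule mult_left_mono)
  moreover have "F \<le> 1 / (2 * \<nu>) * (norm G)\<^sup>2"
    using assms by (simp add: field_simps)
  ultimately show ?thesis by (simp add: algebra_simps add_divide_distrib)
qed

text \<open>
  Along the flow the cross term contributes \<open>- \<beta> * (norm G)\<^sup>2\<close>. Half of it absorbs the mixed term
  \<open>- \<beta> * \<gamma> * (G \<bullet> w)\<close>, and the resulting multiples of \<open>(norm w)\<^sup>2\<close>, together with the one from the
  Hessian, are absorbed by half of the friction.
\<close>
lemma energy_dissipation: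
  fixes G w Aw :: "'a::real_inner"
  assumes "0 < \<beta>" "0 < \<nu>" "2 * \<nu> * F \<le> (norm G)\<^sup>2" "norm Aw \<le> L * norm w"
    and \<beta>: "\<beta> * (\<gamma>\<^sup>2 / 2 + L) \<le> \<gamma> / 2"
    and k: "0 \<le> k" "k * (1 / (2 * \<nu>) + \<beta> / 2) \<le> \<beta> / 2" "k * ((1 + \<beta>) / 2) \<le> \<gamma> / 2"
  shows "w \<bullet> G + w \<bullet> (- (\<gamma> *\<^sub>R w) - G) + \<beta> * (G \<bullet> (- (\<gamma> *\<^sub>R w) - G) + Aw \<bullet> w)
    \<le> - k * (F + (norm w)\<^sup>2 / 2 + \<beta> * (G \<bullet> w))"
proof -
  have "Aw \<bullet> w \<le> norm Aw * norm w" by (rule norm_cauchy_schwarz)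
  also have "\<dots> \<le> (L * norm w) * norm w" using assms by (intro mult_right_mono) auto
  finally have Aw: "Aw \<bullet> w \<le> L * (norm w)\<^sup>2" by (simp add: power2_eq_square)
  have "0 \<le> (norm (G + \<gamma> *\<^sub>R w))\<^sup>2" by simp
  then have cross: "- \<gamma> * (G \<bullet> w) \<le> (norm G)\<^sup>2 / 2 + \<gamma>\<^sup>2 / 2 * (norm w)\<^sup>2"
    unfolding power2_norm_eq_inner
    by (simp add: inner_add_left inner_add_right inner_commute power2_eq_square algebra_simps)
  have "G \<bullet> (- (\<gamma> *\<^sub>R w) - G) + Aw \<bullet> w \<le> (\<gamma>\<^sup>2 / 2 + L) * (norm w)\<^sup>2 - (norm G)\<^sup>2 / 2"
    using cross Aw by (simp add: inner_diff_right power2_norm_eq_inner[of G] algebra_simps)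
  then have "\<beta> * (G \<bullet> (- (\<gamma> *\<^sub>R w) - G) + Aw \<bullet> w)
      \<le> \<beta> * ((\<gamma>\<^sup>2 / 2 + L) * (norm w)\<^sup>2 - (norm G)\<^sup>2 / 2)"
    using \<open>0 < \<beta>\<close> by (intro mult_left_mono) auto
  also have "\<dots> = (\<beta> * (\<gamma>\<^sup>2 / 2 + L)) * (norm w)\<^sup>2 - \<beta> / 2 * (norm G)\<^sup>2"
    by (simp add: algebra_simps)
  also have "\<dots> \<le> (\<gamma> / 2) * (norm w)\<^sup>2 - \<beta> / 2 * (norm G)\<^sup>2"
    using mult_right_mono[OF \<beta>, of "(norm w)\<^sup>2"] by simp
  finally have 1: "w \<bullet> G + w \<bullet> (- (\<gamma> *\<^sub>R w) - G) + \<beta> * (G \<bullet> (- (\<gamma> *\<^sub>R w) - G) + Aw \<bullet> w)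
      \<le> - (\<beta> / 2 * (norm G)\<^sup>2 + \<gamma> / 2 * (norm w)\<^sup>2)"
    by (simp add: inner_diff_right power2_norm_eq_inner[of w])
  have "k * (F + (norm w)\<^sup>2 / 2 + \<beta> * (G \<bullet> w))
      \<le> k * ((1 / (2 * \<nu>) + \<beta> / 2) * (norm G)\<^sup>2 + ((1 + \<beta>) / 2) * (norm w)\<^sup>2)"
    using assms by (intro mult_left_mono energy_upper_bound) auto
  also have "\<dots> = (k * (1 / (2 * \<nu>) + \<beta> / 2)) * (norm G)\<^sup>2 + (k * ((1 + \<beta>) / 2)) * (norm w)\<^sup>2"
    by (simp only: distrib_left[of k "_ * _"] mult.assoc)
  also have "\<dots> \<le> \<beta> / 2 * (norm G)\<^sup>2 + \<gamma> / 2 * (norm w)\<^sup>2"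
    using k by (intro add_mono mult_right_mono) auto
  finally show ?thesis using 1 by simp
qed

definition energy :: "('a::real_inner \<Rightarrow> real) \<Rightarrow> ('a \<Rightarrow> 'a) \<Rightarrow> 'a \<Rightarrow> real \<Rightarrow> 'a \<Rightarrow> 'a \<Rightarrow> real" where
  "energy f g xs \<beta> y w = f y - f xs + (norm w)\<^sup>2 / 2 + \<beta> * (g y \<bullet> w)"

lemma energy_deriv:
  fixes f :: "'a::euclidean_space \<Rightarrow> real"
  assumes fder: "\<And>x. GDERIV f x :> g x" and gder: "\<And>x. (g has_derivative A x) (at x)"
    and x: "(x has_vector_derivative v t) (at t)" and v: "(v has_vector_derivative a) (at t)"
  shows "((\<lambda>t. energy f g xs \<beta> (x t) (v t)) has_real_derivative
      (v t \<bullet> g (x t) + v t \<bullet> a + \<beta> * (g (x t) \<bullet> a + A (x t) (v t) \<bullet> v t))) (at t)"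
proof -
  have A: "linear (A y)" for y
    using gder has_derivative_linear by blast
  have fx: "((\<lambda>t. f (x t)) has_derivative (\<lambda>h. (h *\<^sub>R v t) \<bullet> g (x t))) (at t)"
    using fder[of "x t"] x unfolding gderiv_def has_vector_derivative_def
    by (intro has_derivative_compose[of x _ t UNIV f])
  have gx: "((\<lambda>t. g (x t)) has_derivative (\<lambda>h. A (x t) (h *\<^sub>R v t))) (at t)"
    using gder[of "x t"] x unfolding has_vector_derivative_def
    by (intro has_derivative_compose[of x _ t UNIV g])
  have v': "(v has_derivative (\<lambda>h. h *\<^sub>R a)) (at t)"
    using v unfolding has_vector_derivative_def .
  show ?thesis
    unfolding energy_def has_field_derivative_def power2_norm_eq_inner
    by (auto intro!: derivative_eq_intros fx gx v' simp: linear_scale[OF A] algebra_simps inner_commute)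
qed

text \<open>
  The energy decays like \<open>exp (- k t)\<close> as long as the trajectory stays in the ball, so the speed decays
  like \<open>exp (- k t / 2)\<close> and the remaining length of the trajectory is controlled by the initial
  energy. Starting close enough, the trajectory never reaches the boundary of the ball, has finite
  length and therefore converges; the PL inequality forces the limit to the minimal value.

  The rate \<open>c\<close> is far from sharp. What matters later is that it is fixed before the radius \<open>R\<close>,
  so that \<open>R\<close> may be shrunk afterwards depending on \<open>c\<close>.
\<close>
lemma PL_flow_converges_near_minimizer:
  fixes f :: "'a::euclidean_space \<Rightarrow> real"
  assumes fder: "\<And>x. GDERIV f x :> g x" and gder: "\<And>x. (g has_derivative A x) (at x)"
    and pos: "L > 0" "\<nu> > 0" "\<gamma> > 0"
    and lmin: "\<And>x. x \<in> cball xs R0 \<Longrightarrow> f xs \<le> f x"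
    and PL: "\<And>x. x \<in> cball xs R0 \<Longrightarrow> 2 * \<nu> * (f x - f xs) \<le> (norm (g x))\<^sup>2"
    and gsq: "\<And>x. x \<in> cball xs R0 \<Longrightarrow> (norm (g x))\<^sup>2 \<le> 2 * L * (f x - f xs)"
    and glin: "\<And>x. x \<in> cball xs R0 \<Longrightarrow> norm (g x) \<le> L * norm (x - xs)"
    and Abound: "\<And>x h. x \<in> cball xs R0 \<Longrightarrow> norm (A x h) \<le> L * norm h"
  obtains c where "c > 0"
    and "\<And>R. 0 < R \<Longrightarrow> R \<le> R0 \<Longrightarrow> \<exists>d>0. \<forall>G x v. (\<forall>y\<in>cball xs R. G y = g y) \<longrightarrow> damped_flow G \<gamma> x v \<longrightarrow>
          dist (x 0) xs < d \<longrightarrow> norm (v 0) < d \<longrightarrow>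
          (\<forall>t\<ge>0. x t \<in> ball xs R) \<and>
          (\<exists>z D. (x \<longlongrightarrow> z) at_top \<and> f z = f xs \<and>
             (\<forall>t\<ge>0. norm (x t - z) \<le> D * exp (- c * t) \<and> norm (v t) \<le> D * exp (- c * t)))"
proof -
  define \<beta> where "\<beta> = min (1 / 2) (min (1 / (2 * L)) ((\<gamma> / 2) / (\<gamma>\<^sup>2 / 2 + L)))"
  have "\<gamma>\<^sup>2 / 2 + L > 0" using pos by (simp add: add_nonneg_pos)
  then have "\<beta> > 0" using pos by (simp add: \<beta>_def)
  have \<beta>: "\<beta> \<le> 1/2" "\<beta> * L \<le> 1/2" "\<beta> * (\<gamma>\<^sup>2 / 2 + L) \<le> \<gamma> / 2"
  proof -
    show "\<beta> \<le> 1/2" unfolding \<beta>_def by (rule min.cobounded1)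
    have "\<beta> \<le> 1 / (2 * L)" "\<beta> \<le> (\<gamma> / 2) / (\<gamma>\<^sup>2 / 2 + L)"
      unfolding \<beta>_def by linarith+
    then show "\<beta> * L \<le> 1/2" "\<beta> * (\<gamma>\<^sup>2 / 2 + L) \<le> \<gamma> / 2"
      using pos pos_le_divide_eq[OF \<open>\<gamma>\<^sup>2 / 2 + L > 0\<close>] by (simp add: field_simps, blast)
  qed
  define k where "k = min ((\<beta> / 2) / (1 / (2 * \<nu>) + \<beta> / 2)) ((\<gamma> / 2) / ((1 + \<beta>) / 2))"
  have den: "1 / (2 * \<nu>) + \<beta> / 2 > 0" "(1 + \<beta>) / 2 > 0"
    using pos \<open>\<beta> > 0\<close> by (auto intro!: add_pos_pos)
  have "k > 0" unfolding k_def using den pos \<open>\<beta> > 0\<close> by (simp only: min_less_iff_conj) (intro conjI divide_pos_pos, auto)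
  have k: "k * (1 / (2 * \<nu>) + \<beta> / 2) \<le> \<beta> / 2" "k * ((1 + \<beta>) / 2) \<le> \<gamma> / 2"
    using min.cobounded1 min.cobounded2
    unfolding k_def pos_le_divide_eq[OF den(1), symmetric] pos_le_divide_eq[OF den(2), symmetric]
    by blast+
  define c where "c = k / 2"
  have "c > 0" using \<open>k > 0\<close> by (simp add: c_def)
  \<comment> \<open>The initial energy is at most \<open>K * d\<^sup>2\<close> when position and velocity start within \<open>d\<close>.\<close>
  define K where "K = (1 / (2 * \<nu>) + \<beta> / 2) * L\<^sup>2 + (1 + \<beta>) / 2"
  have "K > 0" unfolding K_def using den pos by (intro add_nonneg_pos) auto
  define E where "E = energy f g xs \<beta>"
  have lower: "(f y - f xs) / 2 + (norm w)\<^sup>2 / 4 \<le> E y w" if "y \<in> cball xs R0" for y w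
    unfolding E_def energy_def
    using \<beta> \<open>\<beta> > 0\<close> lmin[OF that] gsq[OF that] by (intro energy_lower_bound[of \<beta> L]) auto
  have trajectory: "(\<forall>t\<ge>0. x t \<in> ball xs R) \<and>
          (\<exists>z D. (x \<longlongrightarrow> z) at_top \<and> f z = f xs \<and>
             (\<forall>t\<ge>0. norm (x t - z) \<le> D * exp (- c * t) \<and> norm (v t) \<le> D * exp (- c * t)))"
    if R: "0 < R" "R \<le> R0" and d: "0 < d" "d * (1 + 2 / c * sqrt K) < R"
      and G: "\<forall>y\<in>cball xs R. G y = g y" and flow: "damped_flow G \<gamma> x v"
      and x0: "dist (x 0) xs < d" and v0: "norm (v 0) < d" for R d G x v
  proof -
    define e where "e = (\<lambda>t. E (x t) (v t))"
    note cont = damped_flow_continuous[OF flow]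
    have fcont: "continuous_on UNIV f" and gcont: "continuous_on UNIV g"
      using fder gder unfolding gderiv_def
      by (auto intro!: has_derivative_continuous_on)
    have econt: "continuous_on {0..} e"
      unfolding e_def E_def energy_def
      by (intro continuous_intros continuous_on_compose2[OF fcont] continuous_on_compose2[OF gcont] cont) auto
    have "d \<le> d * (1 + 2 / c * sqrt K)" using d \<open>c > 0\<close> \<open>K > 0\<close> by simp
    then have "d < R" using d by linarith
    then have x0R: "x 0 \<in> cball xs R0" using x0 R by (simp add: dist_commute)
    have e0: "e 0 \<le> K * d\<^sup>2"
    proof -
      have "e 0 \<le> (1 / (2 * \<nu>) + \<beta> / 2) * (norm (g (x 0)))\<^sup>2 + ((1 + \<beta>) / 2) * (norm (v 0))\<^sup>2"
        unfolding e_def E_def energy_def using \<open>\<beta> > 0\<close> pos PL[OF x0R] by (intro energy_upper_bound) auto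
      also have "\<dots> \<le> (1 / (2 * \<nu>) + \<beta> / 2) * (L * d)\<^sup>2 + ((1 + \<beta>) / 2) * d\<^sup>2"
      proof (intro add_mono mult_left_mono power_mono)
        show "norm (g (x 0)) \<le> L * d"
          using glin[OF x0R] x0 pos by (smt (verit) dist_norm mult_left_mono)
      qed (use den v0 in auto)
      finally show ?thesis by (simp add: K_def power_mult_distrib algebra_simps)
    qed
    have speed: "norm (v t) \<le> c * (2 / c * (sqrt K * d)) * exp (- c * t)"
      and gap: "f (x t) - f xs \<le> 2 * (K * d\<^sup>2) * exp (- k * t)"
      if t: "0 \<le> t" and inside: "\<And>s. 0 \<le> s \<Longrightarrow> s \<le> t \<Longrightarrow> x s \<in> ball xs R" for t
    proof -
      have "e t \<le> e 0 * exp (- k * (t - 0))"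
      proof (rule gronwall_le[OF t])
        show "continuous_on {0..t} e" using econt by (rule continuous_on_subset) auto
        fix s assume s: "0 < s" "s < t"
        then have xs: "x s \<in> cball xs R" "x s \<in> cball xs R0" using inside[of s] R by auto
        show "\<exists>D. (e has_real_derivative D) (at s) \<and> D \<le> - k * e s"
        proof (intro exI conjI)
          show "(e has_real_derivative (v s \<bullet> g (x s) + v s \<bullet> (- (\<gamma> *\<^sub>R v s) - g (x s))
              + \<beta> * (g (x s) \<bullet> (- (\<gamma> *\<^sub>R v s) - g (x s)) + A (x s) (v s) \<bullet> v s))) (at s)"
            using damped_flow_deriv[OF flow \<open>0 < s\<close>] G xs unfolding e_def E_def
            by (intro energy_deriv[OF fder gder]) auto
          show "v s \<bullet> g (x s) + v s \<bullet> (- (\<gamma> *\<^sub>R v s) - g (x s))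
              + \<beta> * (g (x s) \<bullet> (- (\<gamma> *\<^sub>R v s) - g (x s)) + A (x s) (v s) \<bullet> v s) \<le> - k * e s"
            unfolding e_def E_def energy_def
            using \<open>\<beta> > 0\<close> pos PL[OF xs(2)] Abound[OF xs(2)] \<beta> k \<open>k > 0\<close>
            by (intro energy_dissipation) auto
        qed
      qed
      also have "\<dots> \<le> (K * d\<^sup>2) * exp (- k * t)" using e0 by simp
      finally have et: "e t \<le> (K * d\<^sup>2) * exp (- k * t)" .
      have xt: "x t \<in> cball xs R0" using inside[of t] t R by auto
      note low = lower[OF xt, of "v t"]
      have "0 \<le> (f (x t) - f xs) / 2" using lmin[OF xt] by simp
      then have "(norm (v t))\<^sup>2 \<le> 4 * e t" using low unfolding e_def by linarith
      also have "\<dots> \<le> 4 * ((K * d\<^sup>2) * exp (- k * t))" using et by (intro mult_left_mono) auto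
      also have "\<dots> = (c * (2 / c * (sqrt K * d)) * exp (- c * t))\<^sup>2"
      proof -
        have "exp (- k * t) = (exp (- c * t))\<^sup>2"
          by (simp add: c_def exp_double[symmetric])
        then show ?thesis using \<open>c > 0\<close> \<open>K > 0\<close> by (simp add: power_mult_distrib)
      qed
      finally show "norm (v t) \<le> c * (2 / c * (sqrt K * d)) * exp (- c * t)"
        by (rule power2_le_imp_le) (use \<open>c > 0\<close> \<open>K > 0\<close> d in auto)
      have "(f (x t) - f xs) / 2 \<le> (f (x t) - f xs) / 2 + (norm (v t))\<^sup>2 / 4" by simp
      also have "\<dots> \<le> e t" using low by (simp only: e_def)
      finally have "f (x t) - f xs \<le> 2 * e t" by (simp only: divide_le_eq_numeral1 mult.commute)
      also have "\<dots> \<le> 2 * ((K * d\<^sup>2) * exp (- k * t))" using et by (intro mult_left_mono) auto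
      finally show "f (x t) - f xs \<le> 2 * (K * d\<^sup>2) * exp (- k * t)"
        by (simp only: mult.assoc)
    qed
    have inside: "x t \<in> ball xs R" if "0 \<le> t" for t
    proof (rule ccontr)
      assume out: "x t \<notin> ball xs R"
      \<comment> \<open>The first exit time exists and belongs to this closed set; up to it all estimates are available.\<close>
      define S where "S = {0..} \<inter> (\<lambda>t. dist (x t) xs) -` {R..}"
      have "closed S"
        unfolding S_def by (intro continuous_closed_preimage continuous_intros cont closed_atLeast)
      moreover have "S \<noteq> {}" using out that by (auto simp: S_def dist_commute)
      moreover have "bdd_below S" by (rule bdd_belowI[of _ 0]) (auto simp: S_def)
      ultimately have T: "Inf S \<in> S" by (intro closed_contains_Inf)
      define T where "T = Inf S"
      have "0 \<le> T" "R \<le> dist (x T) xs" using T by (auto simp: S_def T_def)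
      have before: "x s \<in> ball xs R" if "0 \<le> s" "s < T" for s
      proof (rule ccontr)
        assume "x s \<notin> ball xs R"
        then have "s \<in> S" using that by (auto simp: S_def dist_commute)
        then have "T \<le> s" unfolding T_def using \<open>bdd_below S\<close> by (rule cInf_lower)
        with that show False by simp
      qed
      have "norm (x T - x 0) \<le> (2 / c * (sqrt K * d)) * exp (- c * 0) - (2 / c * (sqrt K * d)) * exp (- c * T)"
      proof (rule displacement_le[OF \<open>0 \<le> T\<close>])
        show "continuous_on {0..T} x" using cont(1) by (rule continuous_on_subset) auto
        fix r assume "0 < r" "r < T"
        from damped_flow_deriv(1)[OF flow \<open>0 < r\<close>] show "(x has_vector_derivative v r) (at r)" .
        show "norm (v r) \<le> c * (2 / c * (sqrt K * d)) * exp (- c * r)"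
          using \<open>0 < r\<close> \<open>r < T\<close> by (intro speed before) auto
      qed
      also have "\<dots> \<le> 2 / c * (sqrt K * d)" using \<open>c > 0\<close> \<open>K > 0\<close> d by simp
      finally have "dist (x T) (x 0) \<le> 2 / c * (sqrt K * d)" by (simp add: dist_norm)
      then have "dist (x T) xs < d * (1 + 2 / c * sqrt K)"
        using dist_triangle[of "x T" xs "x 0"] x0 by (simp add: algebra_simps)
      with d \<open>R \<le> dist (x T) xs\<close> show False by linarith
    qed
    have "norm (x t - x s) \<le> (2 / c * (sqrt K * d)) * exp (- c * s)" if "0 \<le> s" "s \<le> t" for s t
    proof -
      have "norm (x t - x s) \<le> (2 / c * (sqrt K * d)) * exp (- c * s) - (2 / c * (sqrt K * d)) * exp (- c * t)"
      proof (rule displacement_le[OF \<open>s \<le> t\<close>])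
        show "continuous_on {s..t} x" using cont(1) by (rule continuous_on_subset) (use that in auto)
        fix r assume "s < r" "r < t"
        then have "0 < r" using that by simp
        from damped_flow_deriv(1)[OF flow this] show "(x has_vector_derivative v r) (at r)" .
        show "norm (v r) \<le> c * (2 / c * (sqrt K * d)) * exp (- c * r)"
          using \<open>0 < r\<close> by (intro speed inside) auto
      qed
      also have "\<dots> \<le> (2 / c * (sqrt K * d)) * exp (- c * s)"
        using \<open>c > 0\<close> \<open>K > 0\<close> d by simp
      finally show ?thesis .
    qed
    from exponentially_cauchy_converges[OF \<open>c > 0\<close> this]
    obtain z where lim: "(x \<longlongrightarrow> z) at_top"
      and z: "\<And>t. 0 \<le> t \<Longrightarrow> norm (x t - z) \<le> (2 / c * (sqrt K * d)) * exp (- c * t)"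
      by blast
    have "((\<lambda>t. f (x t) - f xs) \<longlongrightarrow> 0) at_top"
    proof (rule tendsto_sandwich)
      show "\<forall>\<^sub>F t in at_top. 0 \<le> f (x t) - f xs"
        using eventually_ge_at_top[of 0]
      proof eventually_elim
        fix t :: real assume "0 \<le> t"
        have "x t \<in> cball xs R0" using inside[OF \<open>0 \<le> t\<close>] R by auto
        then show "0 \<le> f (x t) - f xs" using lmin by simp
      qed
      show "\<forall>\<^sub>F t in at_top. f (x t) - f xs \<le> 2 * (K * d\<^sup>2) * exp (- k * t)"
        using eventually_ge_at_top[of 0] by eventually_elim (rule gap[OF _ inside])
      show "((\<lambda>t. 2 * (K * d\<^sup>2) * exp (- k * t)) \<longlongrightarrow> 0) at_top"
      proof (intro tendsto_mult_right_zero filterlim_compose[OF exp_at_bot])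
        show "LIM t at_top. - k * t :> at_bot"
          using \<open>k > 0\<close> by (intro filterlim_tendsto_neg_mult_at_bot[OF tendsto_const] filterlim_ident) auto
      qed
    qed simp
    moreover have "((\<lambda>t. f (x t) - f xs) \<longlongrightarrow> f z - f xs) at_top"
      using fcont lim by (intro tendsto_intros) (auto intro: continuous_on_tendsto_compose)
    ultimately have "f z - f xs = 0" by (intro tendsto_unique[OF trivial_limit_at_top_linorder])
    then have "f z = f xs" by simp
    moreover define D where "D = max (2 / c * (sqrt K * d)) (c * (2 / c * (sqrt K * d)))"
    have "norm (x t - z) \<le> D * exp (- c * t) \<and> norm (v t) \<le> D * exp (- c * t)" if "0 \<le> t" for t
    proof
      have "(2 / c * (sqrt K * d)) * exp (- c * t) \<le> D * exp (- c * t)"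
        unfolding D_def by (rule mult_right_mono[OF max.cobounded1]) simp
      with z[OF that] show "norm (x t - z) \<le> D * exp (- c * t)" by linarith
      have "c * (2 / c * (sqrt K * d)) * exp (- c * t) \<le> D * exp (- c * t)"
        unfolding D_def by (rule mult_right_mono[OF max.cobounded2]) simp
      with speed[OF that inside] show "norm (v t) \<le> D * exp (- c * t)" by (rule order_trans)
    qed
    ultimately show ?thesis using inside lim by blast
  qed
  show thesis
  proof (rule that[OF \<open>c > 0\<close>])
    fix R :: real assume R: "0 < R" "R \<le> R0"
    define q where "q = 1 + 2 / c * sqrt K"
    define d where "d = R / (2 * q)"
    have "q > 0" unfolding q_def using \<open>c > 0\<close> \<open>K > 0\<close> by (intro add_pos_nonneg) auto
    then have "d > 0" "d * q < R"
      using R by (simp_all add: d_def)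
    note trajectory = trajectory[OF R this[unfolded q_def]]
    show "\<exists>d>0. \<forall>G x v. (\<forall>y\<in>cball xs R. G y = g y) \<longrightarrow> damped_flow G \<gamma> x v \<longrightarrow>
          dist (x 0) xs < d \<longrightarrow> norm (v 0) < d \<longrightarrow>
          (\<forall>t\<ge>0. x t \<in> ball xs R) \<and>
          (\<exists>z D. (x \<longlongrightarrow> z) at_top \<and> f z = f xs \<and>
             (\<forall>t\<ge>0. norm (x t - z) \<le> D * exp (- c * t) \<and> norm (v t) \<le> D * exp (- c * t)))"
      using trajectory \<open>d > 0\<close> by blast
  qed
qed

section \<open>The sharp rate of a perturbed linear oscillator\<close>

text \<open>
  \<open>S\<close> is the size of the components that contract at rate \<open>a\<close>, \<open>N\<close> that of a neutral component, and
  \<open>\<eta>\<close> the strength of the coupling. The difference \<open>D = N - S\<close> satisfies \<open>D' \<ge> - 2 * \<eta> * D\<close>, so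
  once it is positive it can decay no faster than \<open>exp (- 2 * \<eta> * t)\<close>. A neutral component that is
  known to decay faster than this must stay below \<open>S\<close> forever, and then it merely costs \<open>\<eta>\<close> in
  the rate of \<open>S\<close>.
\<close>
lemma cone_argument:
  fixes S N :: "real \<Rightarrow> real"
  assumes "0 \<le> \<eta>" "2 * \<eta> \<le> a" "2 * \<eta> < c"
    and S0: "\<And>t. 0 \<le> t \<Longrightarrow> 0 \<le> S t"
    and cont: "continuous_on {0..} S" "continuous_on {0..} N"
    and S': "\<And>t. 0 < t \<Longrightarrow> \<exists>D. (S has_real_derivative D) (at t) \<and> D \<le> - 2 * a * S t + \<eta> * (S t + N t)"
    and N': "\<And>t. 0 < t \<Longrightarrow> \<exists>D. (N has_real_derivative D) (at t) \<and> - \<eta> * (S t + N t) \<le> D"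
    and decay: "\<And>t. 0 \<le> t \<Longrightarrow> N t \<le> B * exp (- c * t)"
    and "0 \<le> t"
  shows "N t \<le> S t" and "S t \<le> S 0 * exp (- 2 * (a - \<eta>) * t)"
proof -
  have inside: "N s \<le> S s" if "0 \<le> s" for s
  proof (rule ccontr)
    assume "\<not> N s \<le> S s"
    define D where "D = (\<lambda>t. N t - S t)"
    have "D s > 0" using \<open>\<not> N s \<le> S s\<close> by (simp add: D_def)
    have grow: "D s * exp (- 2 * \<eta> * (t - s)) \<le> D t" if "s \<le> t" for t
    proof (rule gronwall_ge[OF that])
      show "continuous_on {s..t} D"
        unfolding D_def using \<open>0 \<le> s\<close>
        by (intro continuous_intros continuous_on_subset[OF cont(1)] continuous_on_subset[OF cont(2)]) auto
      fix r assume "s < r" "r < t"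
      then have "0 < r" using \<open>0 \<le> s\<close> by simp
      obtain d1 d2 where d1: "(S has_real_derivative d1) (at r)" "d1 \<le> - 2 * a * S r + \<eta> * (S r + N r)"
        and d2: "(N has_real_derivative d2) (at r)" "- \<eta> * (S r + N r) \<le> d2"
        using S'[OF \<open>0 < r\<close>] N'[OF \<open>0 < r\<close>] by blast
      have "0 \<le> (2 * a - 4 * \<eta>) * S r"
        using S0[of r] \<open>0 < r\<close> \<open>2 * \<eta> \<le> a\<close> by (intro mult_nonneg_nonneg) auto
      then have "- 2 * \<eta> * D r \<le> d2 - d1"
        using d1(2) d2(2) by (simp add: D_def algebra_simps)
      moreover have "(D has_real_derivative d2 - d1) (at r)"
        unfolding D_def by (intro derivative_intros d1 d2)
      ultimately show "\<exists>d. (D has_real_derivative d) (at r) \<and> - 2 * \<eta> * D r \<le> d" by blast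
    qed
    have "((\<lambda>t. B * exp (- (c - 2 * \<eta>) * t)) \<longlongrightarrow> 0) at_top"
    proof (intro tendsto_mult_right_zero filterlim_compose[OF exp_at_bot])
      show "LIM t at_top. - (c - 2 * \<eta>) * t :> at_bot"
        using \<open>2 * \<eta> < c\<close> by (intro filterlim_tendsto_neg_mult_at_bot[OF tendsto_const] filterlim_ident) auto
    qed
    moreover have "\<forall>\<^sub>F t in at_top. D s * exp (2 * \<eta> * s) \<le> B * exp (- (c - 2 * \<eta>) * t)"
      using eventually_ge_at_top[of s]
    proof eventually_elim
      fix t assume "s \<le> t"
      then have "D s * exp (- 2 * \<eta> * (t - s)) \<le> B * exp (- c * t)"
        using grow[of t] decay[of t] S0[of t] \<open>0 \<le> s\<close> by (simp add: D_def)
      then have "exp (2 * \<eta> * t) * (D s * exp (- 2 * \<eta> * (t - s))) \<le> exp (2 * \<eta> * t) * (B * exp (- c * t))"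
        by (intro mult_left_mono) auto
      also have "exp (2 * \<eta> * t) * (D s * exp (- 2 * \<eta> * (t - s))) = D s * exp (2 * \<eta> * s)"
        by (simp add: mult.left_commute exp_add[symmetric] right_diff_distrib)
      also have "exp (2 * \<eta> * t) * (B * exp (- c * t)) = B * exp (- (c - 2 * \<eta>) * t)"
        by (simp add: mult.left_commute exp_add[symmetric] left_diff_distrib)
      finally show "D s * exp (2 * \<eta> * s) \<le> B * exp (- (c - 2 * \<eta>) * t)" .
    qed
    ultimately have "D s * exp (2 * \<eta> * s) \<le> 0"
      by (intro tendsto_lowerbound) auto
    with \<open>D s > 0\<close> show False by (simp add: mult_le_0_iff not_le)
  qed
  then show "N t \<le> S t" using \<open>0 \<le> t\<close> .
  have "S t \<le> S 0 * exp (- 2 * (a - \<eta>) * (t - 0))"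
  proof (rule gronwall_le[OF \<open>0 \<le> t\<close>])
    show "continuous_on {0..t} S" by (rule continuous_on_subset[OF cont(1)]) auto
    fix s assume "0 < s" "s < t"
    then obtain d where d: "(S has_real_derivative d) (at s)" "d \<le> - 2 * a * S s + \<eta> * (S s + N s)"
      using S' by blast
    have "\<eta> * N s \<le> \<eta> * S s"
      using inside[of s] \<open>0 < s\<close> \<open>0 \<le> \<eta>\<close> by (intro mult_left_mono) auto
    then have "d \<le> - 2 * (a - \<eta>) * S s"
      using d(2) by (simp add: algebra_simps)
    with d(1) show "\<exists>d. (S has_real_derivative d) (at s) \<and> d \<le> - 2 * (a - \<eta>) * S s" by blast
  qed
  then show "S t \<le> S 0 * exp (- 2 * (a - \<eta>) * t)" by simp
qed

lemma inner_le_weighted_squares: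
  fixes p r :: "'a::real_inner"
  assumes "c > 0" "norm r \<le> R"
  shows "2 * (p \<bullet> r) \<le> c * (p \<bullet> p) + R\<^sup>2 / c"
proof -
  have "0 \<le> (norm (c *\<^sub>R p - r))\<^sup>2" by simp
  then have "c * (2 * (p \<bullet> r)) \<le> c * (c * (p \<bullet> p)) + (norm r)\<^sup>2"
    unfolding power2_norm_eq_inner
    by (simp add: inner_diff_left inner_diff_right inner_commute)
  also have "(norm r)\<^sup>2 \<le> R\<^sup>2" using assms by (intro power_mono) auto
  also have "c * (c * (p \<bullet> p)) + R\<^sup>2 = c * (c * (p \<bullet> p) + R\<^sup>2 / c)"
    using \<open>c > 0\<close> by (simp add: distrib_left)
  finally show ?thesis using \<open>c > 0\<close> by simp
qed

text \<open>
  The derivative of the stable energy in the proof of the sharp rate, with \<open>q\<close> the velocity along the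
  kernel, \<open>w\<close> the displacement across it and \<open>p = w' + a w\<close>. The choice of \<open>p\<close> makes the terms with
  \<open>Mw \<bullet> p\<close> cancel; strict inequality \<open>2 * a < \<gamma>\<close> leaves friction to absorb the perturbations.
\<close>
lemma stable_energy_dissipation:
  fixes q p w :: "'a::real_inner"
  assumes "0 < a" "2 * a < \<gamma>" "norm r1 \<le> R" "norm r2 \<le> R"
  shows "2 * (q \<bullet> (- (\<gamma> *\<^sub>R q) + r1)) + 2 * (p \<bullet> (- ((\<gamma> - a) *\<^sub>R p) - Mw + r2)) + 2 * (Mw \<bullet> (p - a *\<^sub>R w))
    \<le> - 2 * a * (q \<bullet> q + p \<bullet> p + Mw \<bullet> w) + R\<^sup>2 / (\<gamma> - 2 * a)"
proof -
  have "2 * (q \<bullet> r1) \<le> (2 * (\<gamma> - a)) * (q \<bullet> q) + R\<^sup>2 / (2 * (\<gamma> - a))"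
    using assms by (intro inner_le_weighted_squares) auto
  moreover have "2 * (p \<bullet> r2) \<le> (2 * (\<gamma> - 2 * a)) * (p \<bullet> p) + R\<^sup>2 / (2 * (\<gamma> - 2 * a))"
    using assms by (intro inner_le_weighted_squares) auto
  moreover have "R\<^sup>2 / (2 * (\<gamma> - a)) \<le> R\<^sup>2 / (2 * (\<gamma> - 2 * a))"
    using assms by (intro divide_left_mono mult_pos_pos) auto
  moreover have "y / (2 * d) + y / (2 * d) = y / d" for y d :: real
    by (cases "d = 0") (auto simp: field_simps)
  then have "R\<^sup>2 / (2 * (\<gamma> - 2 * a)) + R\<^sup>2 / (2 * (\<gamma> - 2 * a)) = R\<^sup>2 / (\<gamma> - 2 * a)" .
  ultimately show ?thesis
    by (simp add: inner_diff_right inner_add_right inner_commute[of p Mw] algebra_simps)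
qed

lemma inner_has_real_derivative:
  fixes p q :: "real \<Rightarrow> 'a::real_inner"
  assumes "(p has_vector_derivative p') (at t)" "(q has_vector_derivative q') (at t)"
  shows "((\<lambda>t. p t \<bullet> q t) has_real_derivative (p t \<bullet> q' + p' \<bullet> q t)) (at t)"
  unfolding has_real_derivative_iff_has_vector_derivative
  using assms by (rule bounded_bilinear.has_vector_derivative[OF bounded_bilinear_inner])

text \<open>
  With \<open>z\<close> the limit point, the displacement solves a linear equation with constant matrix \<open>H\<close> up to an
  error of size \<open>\<delta> * norm (x t - z)\<close>. The kernel of \<open>H\<close> contributes a neutral mode and its complement a
  contracting one.

  On the complement, the substitution \<open>w = exp (- a t) * y\<close> turns \<open>w'' + \<gamma> w' + H w = 0\<close> into
  an oscillator with friction \<open>\<gamma> - 2 a > 0\<close> and restoring force \<open>M = H - a (\<gamma> - a)\<close>, which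
  is positive definite there. Up to the factor \<open>exp (2 * a * t) / 2\<close>, its mechanical energy is the
  sum of the last two terms of \<open>S\<close>. No eigenvectors are needed, and the critically damped case with its double root is
  not special. On the kernel the velocity \<open>q\<close> decays at rate \<open>\<gamma>\<close> and is put into \<open>S\<close>, while
  \<open>m = Q (v + \<gamma> (x - z))\<close> is conserved by the unperturbed equation.

  The hypothesis of decay at some rate \<open>c\<close>, however slow, is what excludes drift in the neutral
  direction by the cone argument. Its constant \<open>D\<close> does not enter the conclusion, because \<open>C\<close> and
  \<open>\<delta>\<close> are chosen first.
\<close>
lemma sharp_rate_of_perturbed_flow:
  fixes H :: "'a::euclidean_space \<Rightarrow> 'a"
  assumes "linear H" and sym: "\<And>x y. H x \<bullet> y = H y \<bullet> x"
    and coercive: "\<And>x. (\<And>k. H k = 0 \<Longrightarrow> x \<bullet> k = 0) \<Longrightarrow> \<mu> * (norm x)\<^sup>2 \<le> H x \<bullet> x"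
    and a: "0 < a" "2 * a < \<gamma>" "a * (\<gamma> - a) < \<mu>"
    and \<eta>: "0 < \<eta>" "2 * \<eta> \<le> a" "\<eta> < c"
  obtains C \<delta> where "C > 0" "\<delta> > 0"
    "\<And>G x v z D t. damped_flow G \<gamma> x v \<Longrightarrow>
       (\<And>t. 0 \<le> t \<Longrightarrow> norm (G (x t) - H (x t - z)) \<le> \<delta> * norm (x t - z)) \<Longrightarrow>
       (\<And>t. 0 \<le> t \<Longrightarrow> norm (x t - z) \<le> D * exp (- c * t) \<and> norm (v t) \<le> D * exp (- c * t)) \<Longrightarrow>
       0 \<le> t \<Longrightarrow> norm (x t - z) \<le> C * (norm (x 0 - z) + norm (v 0)) * exp (- (a - \<eta>) * t)"
proof -
  interpret H: linear H by fact
  have blH: "bounded_linear H" using \<open>linear H\<close> by (simp add: linear_conv_bounded_linear)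
  obtain B where "B > 0" and B: "\<And>x. norm (H x) \<le> B * norm x"
    using linear_bounded_pos[OF \<open>linear H\<close>] by blast
  obtain Q where "linear Q" and HQ: "\<And>x. H (Q x) = 0" and QH: "\<And>x. Q (H x) = 0"
    and orth: "\<And>x k. H k = 0 \<Longrightarrow> (x - Q x) \<bullet> k = 0" and Qle: "\<And>x. norm (Q x) \<le> norm x"
    and Ple: "\<And>x. norm (x - Q x) \<le> norm x"
    using kernel_projection_exists[OF \<open>linear H\<close> sym] by metis
  interpret Q: linear Q by fact
  have blQ: "bounded_linear Q" using \<open>linear Q\<close> by (simp add: linear_conv_bounded_linear)
  define b where "b = a * (\<gamma> - a)"
  define \<kappa> where "\<kappa> = \<mu> - b"
  have "b \<ge> 0" "\<kappa> > 0" using a by (auto simp: b_def \<kappa>_def)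
  define M where "M = (\<lambda>w. H w - b *\<^sub>R w)"
  define K where "K = 2 / \<kappa> + 4 / \<gamma>\<^sup>2"
  have "\<gamma> > 0" using a by simp
  then have "K > 0" using \<open>\<kappa> > 0\<close> by (simp add: K_def add_pos_pos)
  \<comment> \<open>The two bounds are what the differential inequalities for \<open>N\<close> and for \<open>S\<close> require of \<open>\<delta>\<^sup>2 * K\<close>.\<close>
  define \<delta> where "\<delta> = sqrt (min (\<eta>\<^sup>2 / 4) (\<eta> * (\<gamma> - 2 * a)) / K)"
  have "\<eta> * (\<gamma> - 2 * a) > 0" using \<eta> a by simp
  then have "\<delta> > 0" using \<open>K > 0\<close> \<eta> by (simp add: \<delta>_def)
  have "\<delta>\<^sup>2 * K = min (\<eta>\<^sup>2 / 4) (\<eta> * (\<gamma> - 2 * a))"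
    using \<open>K > 0\<close> \<open>\<eta> * (\<gamma> - 2 * a) > 0\<close> by (simp add: \<delta>_def)
  then have \<delta>K: "\<delta>\<^sup>2 * K \<le> \<eta>\<^sup>2 / 4" "\<delta>\<^sup>2 * K \<le> \<eta> * (\<gamma> - 2 * a)" by linarith+
  define K0 where "K0 = 1 + (1 + a)\<^sup>2 + B"
  have "K0 > 0" unfolding K0_def using \<open>B > 0\<close> by (intro add_nonneg_pos) auto
  define C where "C = sqrt (2 * K * K0)"
  have "C > 0" using \<open>K > 0\<close> \<open>K0 > 0\<close> by (simp add: C_def)
  have "norm (x t - z) \<le> C * (norm (x 0 - z) + norm (v 0)) * exp (- (a - \<eta>) * t)"
    if flow: "damped_flow G \<gamma> x v"
      and small: "\<And>t. 0 \<le> t \<Longrightarrow> norm (G (x t) - H (x t - z)) \<le> \<delta> * norm (x t - z)"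
      and decay: "\<And>t. 0 \<le> t \<Longrightarrow> norm (x t - z) \<le> D * exp (- c * t) \<and> norm (v t) \<le> D * exp (- c * t)"
      and "0 \<le> t" for G x v z D t
  proof -
    define u where "u = (\<lambda>t. Q (x t - z))"
    define w where "w = (\<lambda>t. (x t - z) - Q (x t - z))"
    define q where "q = (\<lambda>t. Q (v t))"
    define p where "p = (\<lambda>t. (v t - Q (v t)) + a *\<^sub>R w t)"
    define m where "m = (\<lambda>t. Q (v t + \<gamma> *\<^sub>R (x t - z)))"
    define r where "r = (\<lambda>t. H (x t - z) - G (x t))"
    define S where "S = (\<lambda>t. q t \<bullet> q t + p t \<bullet> p t + M (w t) \<bullet> w t)"
    define N where "N = (\<lambda>t. m t \<bullet> m t)"
    note cont = damped_flow_continuous[OF flow]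
    have contQ: "continuous_on T (\<lambda>t. Q (h t))" and contH: "continuous_on T (\<lambda>t. H (h t))"
      if "continuous_on T h" for T :: "real set" and h
      using bounded_linear.continuous_on[OF blQ that] bounded_linear.continuous_on[OF blH that] by auto
    have Mw: "\<kappa> * (norm (w t))\<^sup>2 \<le> M (w t) \<bullet> w t" for t
      using coercive[of "w t"] orth[of _ "x t - z"]
      by (simp add: M_def w_def \<kappa>_def inner_diff_left power2_norm_eq_inner algebra_simps)
    have Mw0: "0 \<le> M (w t) \<bullet> w t" for t
      using Mw[of t] \<open>\<kappa> > 0\<close> by (smt (verit) mult_nonneg_nonneg zero_le_power2)
    have S_nonneg: "0 \<le> S t" and N_nonneg: "0 \<le> N t" for t
      unfolding S_def N_def using Mw0[of t] by auto
    have z_bound: "(norm (x t - z))\<^sup>2 \<le> K * (S t + N t)" for t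
    proof -
      have "u t = (1 / \<gamma>) *\<^sub>R (m t - q t)"
        using \<open>\<gamma> > 0\<close> by (simp add: u_def m_def q_def Q.add Q.scale)
      then have "(norm (u t))\<^sup>2 = (norm (m t - q t))\<^sup>2 / \<gamma>\<^sup>2"
        using \<open>\<gamma> > 0\<close> by (simp add: power_divide)
      also have "(norm (m t - q t))\<^sup>2 \<le> 2 * (m t \<bullet> m t) + 2 * (q t \<bullet> q t)"
        using inner_ge_zero[of "m t + q t"]
        by (simp add: power2_norm_eq_inner inner_diff_left inner_diff_right inner_add_left inner_add_right inner_commute)
      also have "\<dots> \<le> 2 * (S t + N t)"
        using Mw0[of t] by (simp add: S_def N_def)
      finally have u: "(norm (u t))\<^sup>2 \<le> 2 / \<gamma>\<^sup>2 * (S t + N t)"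
        by (simp add: divide_right_mono)
      have "\<kappa> * (norm (w t))\<^sup>2 \<le> S t + N t"
        using Mw[of t] N_nonneg[of t] inner_ge_zero[of "q t"] inner_ge_zero[of "p t"]
        unfolding S_def by linarith
      then have w: "(norm (w t))\<^sup>2 \<le> 1 / \<kappa> * (S t + N t)"
        using \<open>\<kappa> > 0\<close> by (simp add: field_simps)
      have "x t - z = u t + w t" by (simp add: u_def w_def)
      then have "(norm (x t - z))\<^sup>2 \<le> 2 * (norm (u t))\<^sup>2 + 2 * (norm (w t))\<^sup>2"
        using inner_ge_zero[of "u t - w t"]
        by (simp add: power2_norm_eq_inner inner_diff_left inner_diff_right inner_add_left inner_add_right inner_commute)
      also have "\<dots> \<le> 2 * (2 / \<gamma>\<^sup>2 * (S t + N t)) + 2 * (1 / \<kappa> * (S t + N t))"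
        using u w by linarith
      also have "\<dots> = K * (S t + N t)" unfolding K_def by (simp add: distrib_right)
      finally show ?thesis .
    qed
    have r_bound: "(norm (r t))\<^sup>2 \<le> \<delta>\<^sup>2 * K * (S t + N t)" if "0 \<le> t" for t
    proof -
      have "(norm (r t))\<^sup>2 \<le> (\<delta> * norm (x t - z))\<^sup>2"
        using small[OF that] by (intro power_mono) (auto simp: r_def norm_minus_commute)
      also have "\<dots> \<le> \<delta>\<^sup>2 * (K * (S t + N t))"
        unfolding power_mult_distrib by (intro mult_left_mono z_bound) auto
      finally show ?thesis by (simp only: mult.assoc)
    qed
    have ders: "(w has_vector_derivative (p t - a *\<^sub>R w t)) (at t)"
        "(q has_vector_derivative (- (\<gamma> *\<^sub>R q t) + Q (r t))) (at t)"
        "(p has_vector_derivative (- ((\<gamma> - a) *\<^sub>R p t) - M (w t) + (r t - Q (r t)))) (at t)"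
        "(m has_vector_derivative Q (r t)) (at t)" if "0 < t" for t
    proof -
      note dx = damped_flow_deriv(1)[OF flow that] and dv = damped_flow_deriv(2)[OF flow that]
      have dz: "((\<lambda>t. x t - z) has_vector_derivative v t) (at t)"
        using has_vector_derivative_diff[OF dx has_vector_derivative_const] by simp
      note dQz = bounded_linear.has_vector_derivative[OF blQ dz]
        and dQv = bounded_linear.has_vector_derivative[OF blQ dv]
      have dw: "(w has_vector_derivative (v t - Q (v t))) (at t)"
        unfolding w_def by (intro has_vector_derivative_diff dz dQz)
      then show "(w has_vector_derivative (p t - a *\<^sub>R w t)) (at t)"
        by (simp add: p_def)
      have Gr: "G (x t) = H (x t - z) - r t" by (simp add: r_def)
      have Q1: "Q (- (\<gamma> *\<^sub>R v t) - G (x t)) = - (\<gamma> *\<^sub>R q t) + Q (r t)"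
        by (simp add: Gr q_def Q.diff Q.neg Q.scale QH)
      show "(q has_vector_derivative (- (\<gamma> *\<^sub>R q t) + Q (r t))) (at t)"
        using dQv unfolding q_def Q1[unfolded q_def] .
      have "H (x t - z) = H (w t)" by (simp add: w_def H.diff HQ)
      then have "(- (\<gamma> *\<^sub>R v t) - G (x t)) - Q (- (\<gamma> *\<^sub>R v t) - G (x t)) + a *\<^sub>R (v t - Q (v t))
          = - ((\<gamma> - a) *\<^sub>R p t) - M (w t) + (r t - Q (r t))"
        unfolding Q1 unfolding Gr by (simp add: p_def q_def M_def b_def algebra_simps)
      moreover have "(p has_vector_derivative
          ((- (\<gamma> *\<^sub>R v t) - G (x t)) - Q (- (\<gamma> *\<^sub>R v t) - G (x t)) + a *\<^sub>R (v t - Q (v t)))) (at t)"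
        unfolding p_def
        by (intro has_vector_derivative_add has_vector_derivative_diff dv dQv
            bounded_linear.has_vector_derivative[OF bounded_linear_scaleR_right] dw)
      ultimately show "(p has_vector_derivative (- ((\<gamma> - a) *\<^sub>R p t) - M (w t) + (r t - Q (r t)))) (at t)"
        by simp
      have "((\<lambda>t. v t + \<gamma> *\<^sub>R (x t - z)) has_vector_derivative (- (\<gamma> *\<^sub>R v t) - G (x t)) + \<gamma> *\<^sub>R v t) (at t)"
        by (intro has_vector_derivative_add dv bounded_linear.has_vector_derivative[OF bounded_linear_scaleR_right] dz)
      from bounded_linear.has_vector_derivative[OF blQ this]
      show "(m has_vector_derivative Q (r t)) (at t)"
        unfolding m_def by (simp add: Gr Q.diff Q.neg QH)
    qed
    have S': "\<exists>d. (S has_real_derivative d) (at t) \<and> d \<le> - 2 * a * S t + \<eta> * (S t + N t)"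
      if "0 < t" for t
    proof (intro exI conjI)
      note d = ders[OF that]
      have dM: "((\<lambda>t. M (w t)) has_vector_derivative M (p t - a *\<^sub>R w t)) (at t)"
        unfolding M_def
        by (intro has_vector_derivative_diff bounded_linear.has_vector_derivative[OF blH]
            bounded_linear.has_vector_derivative[OF bounded_linear_scaleR_right] d)
      have Msym: "M y \<bullet> y' = M y' \<bullet> y" for y y'
        unfolding M_def inner_diff_left inner_scaleR_left
        using sym[of y y'] inner_commute[of y y'] by simp
      let ?d = "2 * (q t \<bullet> (- (\<gamma> *\<^sub>R q t) + Q (r t)))
          + 2 * (p t \<bullet> (- ((\<gamma> - a) *\<^sub>R p t) - M (w t) + (r t - Q (r t))))
          + 2 * (M (w t) \<bullet> (p t - a *\<^sub>R w t))"
      have "(S has_real_derivative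
          ((q t \<bullet> (- (\<gamma> *\<^sub>R q t) + Q (r t)) + (- (\<gamma> *\<^sub>R q t) + Q (r t)) \<bullet> q t)
          + (p t \<bullet> (- ((\<gamma> - a) *\<^sub>R p t) - M (w t) + (r t - Q (r t)))
             + (- ((\<gamma> - a) *\<^sub>R p t) - M (w t) + (r t - Q (r t))) \<bullet> p t)
          + (M (w t) \<bullet> (p t - a *\<^sub>R w t) + M (p t - a *\<^sub>R w t) \<bullet> w t))) (at t)"
        unfolding S_def by (intro DERIV_add inner_has_real_derivative d dM)
      then show "(S has_real_derivative ?d) (at t)"
        unfolding Msym[of "p t - a *\<^sub>R w t"]
          inner_commute[of "- (\<gamma> *\<^sub>R q t) + Q (r t)" "q t"]
          inner_commute[of "- ((\<gamma> - a) *\<^sub>R p t) - M (w t) + (r t - Q (r t))" "p t"]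
        by (simp only: mult_2)
      have "?d \<le> - 2 * a * S t + (norm (r t))\<^sup>2 / (\<gamma> - 2 * a)"
        unfolding S_def using a Qle Ple by (intro stable_energy_dissipation) auto
      also have "(norm (r t))\<^sup>2 / (\<gamma> - 2 * a) \<le> \<eta> * (S t + N t)"
      proof -
        have "(norm (r t))\<^sup>2 \<le> \<delta>\<^sup>2 * K * (S t + N t)" using that by (intro r_bound) simp
        also have "\<dots> \<le> \<eta> * (\<gamma> - 2 * a) * (S t + N t)"
          using \<delta>K S_nonneg[of t] N_nonneg[of t] by (intro mult_right_mono) auto
        finally show ?thesis using a by (simp add: field_simps)
      qed
      finally show "?d \<le> - 2 * a * S t + \<eta> * (S t + N t)" by simp
    qed
    have N': "\<exists>d. (N has_real_derivative d) (at t) \<and> - \<eta> * (S t + N t) \<le> d" if "0 < t" for t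
    proof (intro exI conjI)
      show "(N has_real_derivative (m t \<bullet> Q (r t) + Q (r t) \<bullet> m t)) (at t)"
        unfolding N_def by (intro inner_has_real_derivative ders that)
      have "2 * (m t \<bullet> - Q (r t)) \<le> (\<eta> / 2) * (m t \<bullet> m t) + (norm (r t))\<^sup>2 / (\<eta> / 2)"
        using \<eta> Qle by (intro inner_le_weighted_squares) auto
      also have "(norm (r t))\<^sup>2 / (\<eta> / 2) \<le> (\<eta> / 2) * (S t + N t)"
      proof -
        have "(norm (r t))\<^sup>2 \<le> \<delta>\<^sup>2 * K * (S t + N t)" using that by (intro r_bound) simp
        also have "\<dots> \<le> \<eta>\<^sup>2 / 4 * (S t + N t)"
          using \<delta>K S_nonneg[of t] N_nonneg[of t] by (intro mult_right_mono) auto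
        finally show ?thesis using \<eta> by (simp add: field_simps power2_eq_square)
      qed
      also have "(\<eta> / 2) * (m t \<bullet> m t) \<le> (\<eta> / 2) * (S t + N t)"
        using \<eta> S_nonneg[of t] by (intro mult_left_mono) (auto simp: N_def)
      finally show "- \<eta> * (S t + N t) \<le> m t \<bullet> Q (r t) + Q (r t) \<bullet> m t"
        by (simp add: inner_commute)
    qed
    have N_decay: "N t \<le> ((1 + \<gamma>) * D)\<^sup>2 * exp (- (2 * c) * t)" if "0 \<le> t" for t
    proof -
      have "norm (m t) \<le> norm (v t + \<gamma> *\<^sub>R (x t - z))" unfolding m_def by (rule Qle)
      also have "\<dots> \<le> norm (v t) + \<gamma> * norm (x t - z)"
        using norm_triangle_ineq[of "v t" "\<gamma> *\<^sub>R (x t - z)"] \<open>\<gamma> > 0\<close> by simp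
      also have "\<dots> \<le> D * exp (- c * t) + \<gamma> * (D * exp (- c * t))"
        using decay[OF that] \<open>\<gamma> > 0\<close> by (intro add_mono mult_left_mono) auto
      also have "\<dots> = (1 + \<gamma>) * D * exp (- c * t)" by (simp add: algebra_simps)
      finally have "(norm (m t))\<^sup>2 \<le> ((1 + \<gamma>) * D * exp (- c * t))\<^sup>2"
        by (intro power_mono) auto
      also have "\<dots> = ((1 + \<gamma>) * D)\<^sup>2 * exp (- (2 * c) * t)"
        by (simp add: power_mult_distrib exp_double[symmetric])
      finally show ?thesis by (simp add: N_def power2_norm_eq_inner)
    qed
    have contS: "continuous_on {0..} S" and contN: "continuous_on {0..} N"
      unfolding S_def N_def q_def p_def w_def m_def M_def
      by (intro continuous_intros contQ contH cont)+
    note cone = cone_argument[OF less_imp_le[OF \<eta>(1)] \<eta>(2) _ S_nonneg contS contN S' N' N_decay]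
    have "2 * \<eta> < 2 * c" using \<eta> by simp
    note cone = cone[OF this, simplified]
    have S0: "S 0 \<le> K0 * (norm (x 0 - z) + norm (v 0))\<^sup>2"
    proof -
      define Z where "Z = norm (x 0 - z) + norm (v 0)"
      have Z: "norm (x 0 - z) \<le> Z" "norm (v 0) \<le> Z" "Z \<ge> 0" by (auto simp: Z_def)
      have wZ: "norm (w 0) \<le> Z" unfolding w_def using Ple[of "x 0 - z"] Z by linarith
      have "norm (q 0) \<le> Z" unfolding q_def using Qle[of "v 0"] Z by linarith
      then have 1: "q 0 \<bullet> q 0 \<le> Z\<^sup>2"
        unfolding power2_norm_eq_inner[symmetric] by (intro power_mono) auto
      have "norm (p 0) \<le> norm (v 0 - Q (v 0)) + a * norm (w 0)"
        unfolding p_def using norm_triangle_ineq[of "v 0 - Q (v 0)" "a *\<^sub>R w 0"] a by simp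
      also have "\<dots> \<le> Z + a * Z"
        using wZ Ple[of "v 0"] Z a by (intro add_mono mult_left_mono) auto
      finally have "norm (p 0) \<le> (1 + a) * Z" by (simp add: algebra_simps)
      then have 2: "p 0 \<bullet> p 0 \<le> (1 + a)\<^sup>2 * Z\<^sup>2"
        unfolding power2_norm_eq_inner[symmetric] power_mult_distrib[symmetric] by (intro power_mono) auto
      have "M (w 0) \<bullet> w 0 \<le> H (w 0) \<bullet> w 0"
        using \<open>b \<ge> 0\<close> by (simp add: M_def inner_diff_left)
      also have "\<dots> \<le> norm (H (w 0)) * norm (w 0)" by (rule norm_cauchy_schwarz)
      also have "\<dots> \<le> (B * norm (w 0)) * norm (w 0)" by (intro mult_right_mono B) auto
      also have "\<dots> \<le> (B * Z) * Z" using wZ Z \<open>B > 0\<close> by (intro mult_mono) auto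
      finally have 3: "M (w 0) \<bullet> w 0 \<le> B * Z\<^sup>2" by (simp add: power2_eq_square)
      show ?thesis using 1 2 3 unfolding S_def K0_def Z_def[symmetric] by (simp add: algebra_simps)
    qed
    have "(norm (x t - z))\<^sup>2 \<le> K * (S t + N t)" by (rule z_bound)
    also have "\<dots> \<le> K * (2 * S t)"
      using cone(1)[OF \<open>0 \<le> t\<close>] \<open>K > 0\<close> by (intro mult_left_mono) auto
    also have "\<dots> \<le> K * (2 * (K0 * (norm (x 0 - z) + norm (v 0))\<^sup>2 * exp (- 2 * (a - \<eta>) * t)))"
    proof -
      have "S t \<le> S 0 * exp (- 2 * (a - \<eta>) * t)" using cone(2)[OF \<open>0 \<le> t\<close>] by simp
      also have "\<dots> \<le> K0 * (norm (x 0 - z) + norm (v 0))\<^sup>2 * exp (- 2 * (a - \<eta>) * t)"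
        using S0 by (intro mult_right_mono) auto
      finally show ?thesis using \<open>K > 0\<close> by simp
    qed
    also have "\<dots> = (C * (norm (x 0 - z) + norm (v 0)) * exp (- (a - \<eta>) * t))\<^sup>2"
    proof -
      have "exp (- 2 * (a - \<eta>) * t) = (exp (- (a - \<eta>) * t))\<^sup>2"
        by (simp add: exp_double[symmetric])
      moreover have "C\<^sup>2 = 2 * K * K0" using \<open>K > 0\<close> \<open>K0 > 0\<close> by (simp add: C_def)
      ultimately show ?thesis by (simp add: power_mult_distrib)
    qed
    finally show ?thesis
      by (rule power2_le_imp_le) (use \<open>C > 0\<close> in auto)
  qed
  with \<open>C > 0\<close> \<open>\<delta> > 0\<close> show thesis by (rule that)
qed

section \<open>Global solutions of Lipschitz differential equations\<close>

lemma primitive_has_vector_derivative_halfline: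
  fixes g :: "real \<Rightarrow> 'a::banach"
  assumes "continuous_on {0..} g" "0 \<le> t"
  shows "((\<lambda>u. integral {0..u} g) has_vector_derivative g t) (at t within {0..})"
proof -
  have "((\<lambda>u. integral {0..u} g) has_vector_derivative g t) (at t within {0..t + 1})"
    using assms by (intro integral_has_vector_derivative continuous_on_subset[OF assms(1)]) auto
  moreover have "at t within {0..} = at t within {0..t + 1}"
    by (rule at_within_nhd[of t "{..<t + 1}"]) auto
  ultimately show ?thesis by simp
qed

lemma exponential_growth_bound:
  fixes Y :: "real \<Rightarrow> 'a::real_normed_vector"
  assumes "c > 0" "K \<ge> 0" "Y 0 = 0" "0 \<le> t"
    and der: "\<And>s. 0 \<le> s \<Longrightarrow> (Y has_vector_derivative y s) (at s within {0..})"
    and bound: "\<And>s. 0 \<le> s \<Longrightarrow> norm (y s) \<le> K * exp (c * s)"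
  shows "norm (Y t) \<le> K / c * exp (c * t)"
proof -
  have "norm (Y t - Y 0) \<le> (- K / c) * exp (- (- c) * 0) - (- K / c) * exp (- (- c) * t)"
  proof (rule displacement_le[OF \<open>0 \<le> t\<close>])
    show "continuous_on {0..t} Y"
      by (rule continuous_on_subset[OF continuous_on_vector_derivative[of "{0..}"]]) (use der in auto)
    fix s assume s: "0 < s" "s < t"
    have "at s within {0..} = at s"
      using s by (intro at_within_interior) (simp add: interior_real_atLeast)
    then show "(Y has_vector_derivative y s) (at s)" using der[of s] s by simp
    show "norm (y s) \<le> - c * (- K / c) * exp (- (- c) * s)"
      using bound[of s] s \<open>c > 0\<close> by simp
  qed
  also have "\<dots> \<le> K / c * exp (c * t)" using \<open>c > 0\<close> \<open>K \<ge> 0\<close> by simp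
  finally show ?thesis using \<open>Y 0 = 0\<close> by simp
qed

text \<open>
  Picard iteration in the weighted variable \<open>exp (- c t) * y t\<close>. With \<open>c > 2 L\<close> the integral operator
  contracts by 1/2 in the supremum norm on the whole half-line, so a single application of Banach's
  theorem gives a global solution.
\<close>
lemma global_solution_of_Lipschitz_ODE:
  fixes F :: "'a::banach \<Rightarrow> 'a"
  assumes "0 \<le> L" and lip: "\<And>x y. norm (F x - F y) \<le> L * norm (x - y)"
  obtains y where "y 0 = y0" "\<And>t. 0 \<le> t \<Longrightarrow> (y has_vector_derivative F (y t)) (at t within {0..})"
proof -
  define c where "c = 2 * L + 1"
  have "c > 0" "L / c \<le> 1 / 2" using \<open>0 \<le> L\<close> by (auto simp: c_def field_simps)
  define g where "g = (\<lambda>z :: real \<Rightarrow>\<^sub>C 'a. \<lambda>s. F (exp (c * s) *\<^sub>R apply_bcontfun z s))"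
  define I where "I = (\<lambda>z t. integral {0..t} (g z))"
  \<comment> \<open>Values at negative times are frozen, so that continuous functions on the whole line can be used.\<close>
  define T where "T = (\<lambda>z t. exp (- c * max 0 t) *\<^sub>R (y0 + I z (max 0 t)))"
  have "continuous_on UNIV F"
    by (rule lipschitz_on_continuous_on[OF lipschitz_onI[of _ _ L]]) (use lip \<open>0 \<le> L\<close> in \<open>auto simp: dist_norm\<close>)
  then have gcont: "continuous_on A (g z)" for z A
    unfolding g_def
    by (rule continuous_on_compose2) (auto intro!: continuous_intros)
  have I': "(I z has_vector_derivative g z t) (at t within {0..})" if "0 \<le> t" for z t
    unfolding I_def using gcont that by (rule primitive_has_vector_derivative_halfline)
  have I0: "I z 0 = 0" for z by (simp add: I_def)
  have Icont: "continuous_on {0..} (I z)" for z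
    using I' by (intro continuous_on_vector_derivative[of _ _ "g z"]) auto
  have Tcont: "continuous_on UNIV (T z)" for z
    unfolding T_def by (intro continuous_intros continuous_on_compose2[OF Icont]) auto
  have Tb: "T z \<in> bcontfun" for z
  proof (rule bcontfun_normI[OF Tcont])
    fix t :: real
    define \<tau> where "\<tau> = max 0 t"
    have "0 \<le> \<tau>" by (simp add: \<tau>_def)
    have "norm (I z \<tau>) \<le> (norm (F 0) + L * norm z) / c * exp (c * \<tau>)"
    proof (rule exponential_growth_bound[OF \<open>c > 0\<close> _ I0 \<open>0 \<le> \<tau>\<close> I'])
      show "0 \<le> norm (F 0) + L * norm z" using \<open>0 \<le> L\<close> by simp
      fix s :: real assume "0 \<le> s"
      have "norm (g z s) \<le> norm (F 0) + norm (g z s - F 0)"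
        using norm_triangle_ineq[of "F 0" "g z s - F 0"] by simp
      also have "\<dots> \<le> norm (F 0) + L * (exp (c * s) * norm (apply_bcontfun z s))"
        using lip[of "exp (c * s) *\<^sub>R apply_bcontfun z s" 0] by (simp add: g_def)
      also have "\<dots> \<le> norm (F 0) * exp (c * s) + L * (exp (c * s) * norm z)"
        using \<open>0 \<le> s\<close> \<open>c > 0\<close> \<open>0 \<le> L\<close>
        by (intro add_mono mult_left_mono norm_bounded) (auto simp: mult_le_cancel_left1)
      finally show "norm (g z s) \<le> (norm (F 0) + L * norm z) * exp (c * s)"
        by (simp add: algebra_simps)
    qed
    then have "norm (y0 + I z \<tau>) \<le> norm y0 + (norm (F 0) + L * norm z) / c * exp (c * \<tau>)"
      using norm_triangle_ineq[of y0 "I z \<tau>"] by linarith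
    then have "exp (- c * \<tau>) * norm (y0 + I z \<tau>)
        \<le> exp (- c * \<tau>) * (norm y0 + (norm (F 0) + L * norm z) / c * exp (c * \<tau>))"
      by (intro mult_left_mono) auto
    also have "\<dots> = exp (- c * \<tau>) * norm y0 + (norm (F 0) + L * norm z) / c"
      by (simp add: distrib_left exp_minus)
    also have "\<dots> \<le> norm y0 + (norm (F 0) + L * norm z) / c"
      using \<open>0 \<le> \<tau>\<close> \<open>c > 0\<close> by (simp add: mult_left_le_one_le)
    finally show "norm (T z t) \<le> norm y0 + (norm (F 0) + L * norm z) / c"
      by (simp add: T_def \<tau>_def[symmetric])
  qed
  define \<Phi> where "\<Phi> = (\<lambda>z. Bcontfun (T z))"
  have \<Phi>: "apply_bcontfun (\<Phi> z) = T z" for z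
    unfolding \<Phi>_def by (rule Bcontfun_inverse[OF Tb])
  have "\<exists>!z. \<Phi> z = z"
  proof (rule banach_fix_type)
    show "\<forall>z1 z2. dist (\<Phi> z1) (\<Phi> z2) \<le> 1 / 2 * dist z1 z2"
    proof (intro allI dist_bound)
      fix z1 z2 :: "real \<Rightarrow>\<^sub>C 'a" and t :: real
      define \<tau> where "\<tau> = max 0 t"
      have "0 \<le> \<tau>" by (simp add: \<tau>_def)
      have "norm (I z1 \<tau> - I z2 \<tau>) \<le> (L * dist z1 z2) / c * exp (c * \<tau>)"
      proof (rule exponential_growth_bound[OF \<open>c > 0\<close> _ _ \<open>0 \<le> \<tau>\<close>, of _ "\<lambda>t. I z1 t - I z2 t"])
        show "((\<lambda>t. I z1 t - I z2 t) has_vector_derivative g z1 s - g z2 s) (at s within {0..})"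
          if "0 \<le> s" for s using that by (intro has_vector_derivative_diff I')
        fix s :: real
        have "norm (g z1 s - g z2 s) \<le> L * (exp (c * s) * dist (apply_bcontfun z1 s) (apply_bcontfun z2 s))"
          using lip[of "exp (c * s) *\<^sub>R apply_bcontfun z1 s" "exp (c * s) *\<^sub>R apply_bcontfun z2 s"]
          by (simp add: g_def dist_norm scaleR_diff_right[symmetric])
        also have "\<dots> \<le> L * (exp (c * s) * dist z1 z2)"
          using \<open>0 \<le> L\<close> by (intro mult_left_mono dist_bounded) auto
        finally show "norm (g z1 s - g z2 s) \<le> L * dist z1 z2 * exp (c * s)"
          by (simp add: mult_ac)
      qed (use \<open>0 \<le> L\<close> I0 in auto)
      then have "exp (- c * \<tau>) * norm (I z1 \<tau> - I z2 \<tau>)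
          \<le> exp (- c * \<tau>) * ((L * dist z1 z2) / c * exp (c * \<tau>))"
        by (intro mult_left_mono) auto
      also have "\<dots> = L / c * dist z1 z2" by (simp add: exp_minus)
      also have "\<dots> \<le> 1 / 2 * dist z1 z2" using \<open>L / c \<le> 1 / 2\<close> by (intro mult_right_mono) auto
      finally show "dist (apply_bcontfun (\<Phi> z1) t) (apply_bcontfun (\<Phi> z2) t) \<le> 1 / 2 * dist z1 z2"
        by (simp add: \<Phi> T_def \<tau>_def[symmetric] dist_norm scaleR_diff_right[symmetric])
    qed
  qed auto
  then obtain z where "\<Phi> z = z" by blast
  then have z: "apply_bcontfun z t = T z t" for t using \<Phi>[of z] by simp
  define y where "y = (\<lambda>t. y0 + I z t)"
  have gy: "g z t = F (y t)" if "0 \<le> t" for t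
    using that by (simp add: g_def z T_def y_def exp_minus)
  show thesis
  proof
    show "y 0 = y0" by (simp add: y_def I0)
    fix t :: real assume "0 \<le> t"
    have "(y has_vector_derivative 0 + g z t) (at t within {0..})"
      unfolding y_def using \<open>0 \<le> t\<close> by (intro has_vector_derivative_add has_vector_derivative_const I')
    then show "(y has_vector_derivative F (y t)) (at t within {0..})"
      using gy[OF \<open>0 \<le> t\<close>] by simp
  qed
qed

lemma damped_flow_exists:
  fixes G :: "'a::banach \<Rightarrow> 'a"
  assumes "0 \<le> L" and lip: "\<And>x y. norm (G x - G y) \<le> L * norm (x - y)"
  obtains x v where "damped_flow G \<gamma> x v" "x 0 = x0" "v 0 = v0"
proof -
  define F where "F = (\<lambda>(x, v). (v, - (\<gamma> *\<^sub>R v) - G x))"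
  have "norm (F p - F q) \<le> (1 + \<bar>\<gamma>\<bar> + L) * norm (p - q)" for p q
  proof -
    obtain x v where p: "p = (x, v)" by (cases p)
    obtain x' v' where q: "q = (x', v')" by (cases q)
    have le: "norm (x - x') \<le> norm (p - q)" "norm (v - v') \<le> norm (p - q)"
      using norm_fst_le[of "x - x'" "v - v'"] norm_snd_le[of "v - v'" "x - x'"] by (simp_all add: p q)
    have "F p - F q = (v - v', - (\<gamma> *\<^sub>R (v - v')) - (G x - G x'))"
      by (simp add: F_def p q scaleR_diff_right)
    then have "norm (F p - F q) \<le> norm (v - v') + norm (- (\<gamma> *\<^sub>R (v - v')) - (G x - G x'))"
      using norm_Pair_le by metis
    also have "\<dots> \<le> norm (v - v') + (\<bar>\<gamma>\<bar> * norm (v - v') + norm (G x - G x'))"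
      using norm_triangle_ineq4[of "- (\<gamma> *\<^sub>R (v - v'))" "G x - G x'"] by simp
    also have "\<dots> \<le> norm (p - q) + (\<bar>\<gamma>\<bar> * norm (p - q) + L * norm (p - q))"
    proof (intro add_mono mult_left_mono le)
      have "norm (G x - G x') \<le> L * norm (x - x')" by (rule lip)
      also have "\<dots> \<le> L * norm (p - q)" using le \<open>0 \<le> L\<close> by (intro mult_left_mono) auto
      finally show "norm (G x - G x') \<le> L * norm (p - q)" .
    qed auto
    finally show ?thesis by (simp add: algebra_simps)
  qed
  moreover have "0 \<le> 1 + \<bar>\<gamma>\<bar> + L" using \<open>0 \<le> L\<close> by simp
  ultimately obtain y where y0: "y 0 = (x0, v0)"
    and y: "\<And>t. 0 \<le> t \<Longrightarrow> (y has_vector_derivative F (y t)) (at t within {0..})"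
    using global_solution_of_Lipschitz_ODE[of "1 + \<bar>\<gamma>\<bar> + L" F "(x0, v0)"] by metis
  have "damped_flow G \<gamma> (\<lambda>t. fst (y t)) (\<lambda>t. snd (y t))"
    unfolding damped_flow_def
  proof (intro allI impI conjI)
    fix t :: real assume "0 \<le> t"
    from bounded_linear.has_vector_derivative[OF bounded_linear_fst y[OF this]]
    show "((\<lambda>t. fst (y t)) has_vector_derivative snd (y t)) (at t within {0..})"
      by (simp add: F_def case_prod_beta)
    from bounded_linear.has_vector_derivative[OF bounded_linear_snd y[OF \<open>0 \<le> t\<close>]]
    show "((\<lambda>t. snd (y t)) has_vector_derivative - (\<gamma> *\<^sub>R snd (y t)) - G (fst (y t))) (at t within {0..})"
      by (simp add: F_def case_prod_beta)
  qed
  then show thesis using y0 that by simp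
qed

section \<open>The heavy ball flow near a minimizer\<close>

text \<open>
  Being the least nonzero eigenvalue, it is at most the Rayleigh minimum, which is a nonzero eigenvalue too.
  A nonzero \<open>A\<close> is required for the set of nonzero eigenvalues to be inhabited.
\<close>
lemma smallest_nonzero_eigenvalue_coercive:
  fixes A :: "real ^ 'n ^ 'n"
  assumes sym: "\<And>x y. (A *v x) \<bullet> y = (A *v y) \<bullet> x" and psd: "\<And>x. 0 \<le> (A *v x) \<bullet> x"
    and "A *v h \<noteq> 0"
  shows "0 < smallest_nonzero_eigenvalue A"
    and "(\<And>k. A *v k = 0 \<Longrightarrow> x \<bullet> k = 0) \<Longrightarrow> smallest_nonzero_eigenvalue A * (norm x)\<^sup>2 \<le> (A *v x) \<bullet> x"
proof -
  define E where "E = {l. eigenvalue A l \<and> l \<noteq> 0}"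
  have min: "smallest_nonzero_eigenvalue A = Min E"
    by (simp add: smallest_nonzero_eigenvalue_def E_def)
  have "finite E"
    by (rule finite_subset[OF _ finite_eigenvalues_symmetric[of "(*v) A", OF sym]])
      (auto simp: E_def eigenvalue_def)
  obtain l w where l: "l > 0" "w \<noteq> 0" "A *v w = l *\<^sub>R w"
    and bound: "\<And>x. (\<And>k. A *v k = 0 \<Longrightarrow> x \<bullet> k = 0) \<Longrightarrow> l * (norm x)\<^sup>2 \<le> (A *v x) \<bullet> x"
    using rayleigh_minimum_on_kernel_complement[OF matrix_vector_mul_linear sym psd \<open>A *v h \<noteq> 0\<close>]
    by metis
  have "l \<in> E" using l by (auto simp: E_def eigenvalue_def)
  have "Min E \<in> E" using \<open>finite E\<close> \<open>l \<in> E\<close> by (intro Min_in) auto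
  then obtain u where u: "u \<noteq> 0" "A *v u = Min E *\<^sub>R u" and "Min E \<noteq> 0"
    by (auto simp: E_def eigenvalue_def)
  have "0 \<le> Min E * (u \<bullet> u)" using psd[of u] u by simp
  moreover have "0 < u \<bullet> u" using u(1) by simp
  ultimately have "0 \<le> Min E" by (metis mult_neg_pos not_le)
  with \<open>Min E \<noteq> 0\<close> show "0 < smallest_nonzero_eigenvalue A" by (simp add: min)
  assume "\<And>k. A *v k = 0 \<Longrightarrow> x \<bullet> k = 0"
  then have "l * (norm x)\<^sup>2 \<le> (A *v x) \<bullet> x" by (rule bound)
  moreover have "Min E * (norm x)\<^sup>2 \<le> l * (norm x)\<^sup>2"
    using \<open>finite E\<close> \<open>l \<in> E\<close> by (intro mult_right_mono Min_le) auto
  ultimately show "smallest_nonzero_eigenvalue A * (norm x)\<^sup>2 \<le> (A *v x) \<bullet> x"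
    by (simp add: min)
qed

lemma hessian_modulus:
  fixes f :: "real ^ 'n \<Rightarrow> real"
  assumes "continuous_on UNIV (hessian f)" "e > 0"
  shows "\<exists>r>0. \<forall>y. dist y x < r \<longrightarrow> (\<forall>h. norm (hessian f y *v h - hessian f x *v h) \<le> e * norm h)"
proof -
  have "bilinear ((*v) :: real ^ 'n ^ 'n \<Rightarrow> real ^ 'n \<Rightarrow> real ^ 'n)"
    unfolding bilinear_def linear_iff
    by (simp add: matrix_vector_mult_add_rdistrib matrix_vector_right_distrib
        scaleR_matrix_vector_assoc matrix_vector_mult_scaleR)
  then interpret mv: bounded_bilinear "(*v) :: real ^ 'n ^ 'n \<Rightarrow> real ^ 'n \<Rightarrow> real ^ 'n"
    by (simp add: bilinear_conv_bounded_bilinear)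
  obtain K where "K > 0" and K: "\<And>(A :: real ^ 'n ^ 'n) h. norm (A *v h) \<le> norm A * norm h * K"
    using mv.pos_bounded by blast
  have "isCont (hessian f) x"
    using assms(1) by (simp add: continuous_on_eq_continuous_at)
  moreover have "e / K > 0" using \<open>e > 0\<close> \<open>K > 0\<close> by simp
  ultimately obtain r where "r > 0" and r: "\<And>y. dist y x < r \<Longrightarrow> dist (hessian f y) (hessian f x) < e / K"
    unfolding continuous_at_eps_delta by blast
  have "norm (hessian f y *v h - hessian f x *v h) \<le> e * norm h" if "dist y x < r" for y h
  proof -
    have "norm (hessian f y *v h - hessian f x *v h) \<le> norm (hessian f y - hessian f x) * norm h * K"
      using K[of "hessian f y - hessian f x" h] by (simp add: mv.diff_left)
    also have "\<dots> \<le> e / K * norm h * K"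
      using r[OF that] \<open>K > 0\<close> by (intro mult_right_mono) (auto simp: dist_norm)
    finally show ?thesis using \<open>K > 0\<close> by simp
  qed
  with \<open>r > 0\<close> show ?thesis by blast
qed

lemma heavy_ball_iff_damped_flow: "heavy_ball f \<gamma> x v \<longleftrightarrow> damped_flow (grad f) \<gamma> x v"
proof -
  have "a + \<gamma> *\<^sub>R w + y = 0 \<longleftrightarrow> a = - (\<gamma> *\<^sub>R w) - y" for a w y :: "real ^ 'n"
    by (auto simp: algebra_simps eq_neg_iff_add_eq_0)
  note eq = this
  show ?thesis unfolding heavy_ball_def damped_flow_def eq by simp
qed

lemma damped_flow_cong:
  assumes "damped_flow G \<gamma> x v" "\<And>t. 0 \<le> t \<Longrightarrow> G (x t) = G' (x t)"
  shows "damped_flow G' \<gamma> x v"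
  using assms by (simp add: damped_flow_def)

lemma rate_le_half: "rate \<mu> \<gamma> \<le> \<gamma> / 2"
  by (simp add: rate_def)

lemma rate_pos: "0 < \<mu> \<Longrightarrow> 0 < \<gamma> \<Longrightarrow> 0 < rate \<mu> \<gamma>"
  using real_sqrt_less_mono[of "max 0 (\<gamma>\<^sup>2 - 4 * \<mu>)" "\<gamma>\<^sup>2"] by (simp add: rate_def)

text \<open>
  In the overdamped case the rate is the smaller root of \<open>r * (\<gamma> - r) = \<mu>\<close>; otherwise it is
  \<open>\<gamma> / 2\<close>, where \<open>r * (\<gamma> - r)\<close> has its maximum \<open>\<gamma>\<^sup>2 / 4 \<le> \<mu>\<close>.
\<close>
lemma rate_quadratic: "rate \<mu> \<gamma> * (\<gamma> - rate \<mu> \<gamma>) \<le> \<mu>"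
proof -
  define s where "s = sqrt (max 0 (\<gamma>\<^sup>2 - 4 * \<mu>))"
  have rate: "rate \<mu> \<gamma> = (\<gamma> - s) / 2" by (simp add: rate_def s_def)
  have "(\<gamma> - s) / 2 * (\<gamma> - (\<gamma> - s) / 2) = (\<gamma>\<^sup>2 - s\<^sup>2) / 4"
    by (simp add: power2_eq_square field_simps)
  also have "\<dots> \<le> \<mu>" by (simp add: s_def)
  finally show ?thesis unfolding rate .
qed

lemma rate_at_critical_damping: "0 \<le> \<mu> \<Longrightarrow> rate \<mu> (2 * sqrt \<mu>) = sqrt \<mu>"
  by (simp add: rate_def power_mult_distrib)

lemma rate_le_sqrt:
  assumes "0 < \<mu>" "0 < \<gamma>"
  shows "rate \<mu> \<gamma> \<le> sqrt \<mu>"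
proof -
  have "rate \<mu> \<gamma> * rate \<mu> \<gamma> \<le> rate \<mu> \<gamma> * (\<gamma> - rate \<mu> \<gamma>)"
    using rate_pos[OF assms] rate_le_half[of \<mu> \<gamma>] by (intro mult_left_mono) auto
  also have "\<dots> \<le> \<mu>" by (rule rate_quadratic)
  finally show ?thesis by (intro real_le_rsqrt) (simp add: power2_eq_square)
qed

text \<open>
  These are the two conditions under which the shifted oscillator in the proof of the sharp rate
  has positive friction and positive definite restoring force.
\<close>
lemma below_rate:
  assumes "0 < a" "a < rate \<mu> \<gamma>"
  shows "2 * a < \<gamma>" "a * (\<gamma> - a) < \<mu>"
proof -
  have half: "2 * rate \<mu> \<gamma> \<le> \<gamma>" using rate_le_half[of \<mu> \<gamma>] by simp
  then show "2 * a < \<gamma>" using assms by simp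
  have "0 < (rate \<mu> \<gamma> - a) * (\<gamma> - rate \<mu> \<gamma> - a)"
    using assms half by (intro mult_pos_pos) auto
  then show "a * (\<gamma> - a) < \<mu>"
    using rate_quadratic[of \<mu> \<gamma>] by (simp add: algebra_simps)
qed

text \<open>
  The order of choices is essential. A first radius \<open>R0\<close> makes all local estimates valid and yields the
  a priori rate \<open>c\<close>. Only then are \<open>a\<close> and \<open>\<eta>\<close> chosen from \<open>\<epsilon>\<close> and \<open>c\<close>, which fixes the admissible
  linearization error \<open>\<delta>\<close>, then a radius \<open>R\<close> on which that error is attained, and finally the size
  \<open>d\<close> of the set of initial conditions.

  Existence of trajectories follows by composing the gradient with the projection onto the ball. The
  new field is globally Lipschitz, and its solutions never leave the ball, where it is the gradient.
\<close>
lemma heavy_ball_local_rate: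
  fixes f :: "real ^ 'n \<Rightarrow> real"
  assumes "C2 f" "local_minimizer f xs" "local_PL f xs"
    and nonconst: "\<not> (\<exists>V. open V \<and> xs \<in> V \<and> f constant_on V)"
    and \<mu>: "\<mu> = smallest_nonzero_eigenvalue (hessian f xs)"
  shows "0 < \<mu>"
    and "0 < \<gamma> \<Longrightarrow> 0 < \<epsilon> \<Longrightarrow> \<epsilon> < rate \<mu> \<gamma> \<Longrightarrow>
       (\<exists>U C. open U \<and> (xs, 0) \<in> U \<and> C > 0 \<and>
         (\<forall>x0 v0. (x0, v0) \<in> U \<longrightarrow>
           (\<exists>x v. heavy_ball f \<gamma> x v \<and> x 0 = x0 \<and> v 0 = v0) \<and>
           (\<forall>x v. heavy_ball f \<gamma> x v \<and> x 0 = x0 \<and> v 0 = v0 \<longrightarrow>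
             (\<exists>xs'\<in>minimizer_set f xs. (x \<longlongrightarrow> xs') at_top \<and>
               (\<forall>t\<ge>0. norm (x t - xs')
                  \<le> C * (norm (x 0 - xs') + norm (v 0)) * exp (- (rate \<mu> \<gamma> - \<epsilon>) * t))))))"
proof -
  define g where "g = grad f"
  define A where "A = (\<lambda>x h. hessian f x *v h)"
  define H where "H = A xs"
  have fder: "GDERIV f x :> g x" for x
    using \<open>C2 f\<close> unfolding C2_def g_def by (intro GDERIV_grad) auto
  have gder: "(g has_derivative A x) (at x)" for x
    using \<open>C2 f\<close> unfolding C2_def A_def g_def hessian_def by (simp add: jacobian_works[symmetric])
  have Acont: "\<exists>r>0. \<forall>y. dist y xs < r \<longrightarrow> (\<forall>h. norm (A y h - A xs h) \<le> e * norm h)" if "e > 0" for e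
    using \<open>C2 f\<close> that unfolding C2_def A_def by (intro hessian_modulus) auto
  have "linear H" unfolding H_def A_def by (rule matrix_vector_mul_linear)
  have approx: "\<exists>r>0. \<forall>x\<in>cball xs r. \<forall>y\<in>cball xs r. norm (g x - g y - H (x - y)) \<le> e * norm (x - y)"
    if "e > 0" for e
    unfolding H_def using gder Acont that by (rule gradient_linearization)
  obtain B where "B > 0" and B: "\<And>h. norm (H h) \<le> B * norm h"
    using linear_bounded_pos[OF \<open>linear H\<close>] by blast
  obtain V1 where V1: "open V1" "xs \<in> V1" "\<And>y. y \<in> V1 \<Longrightarrow> f xs \<le> f y"
    using \<open>local_minimizer f xs\<close> unfolding local_minimizer_def by blast
  obtain V2 \<nu> where V2: "open V2" "xs \<in> V2" and "\<nu> > 0"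
    and PL2: "\<And>y. y \<in> V2 \<Longrightarrow> 2 * \<nu> * (f y - f xs) \<le> (norm (g y))\<^sup>2"
    using \<open>local_PL f xs\<close> unfolding local_PL_def g_def by blast
  obtain r0 where "r0 > 0" and r0: "cball xs r0 \<subseteq> V1 \<inter> V2"
    using V1 V2 open_contains_cball[of "V1 \<inter> V2"] by blast
  have lmin: "f xs \<le> f y" and PL: "2 * \<nu> * (f y - f xs) \<le> (norm (g y))\<^sup>2" if "y \<in> cball xs r0" for y
    using that r0 V1 PL2 by blast+
  have "g xs = 0"
    using gradient_zero_at_local_min[OF fder V1] .
  have sym: "H x \<bullet> y = H y \<bullet> x" for x y
    by (rule hessian_symmetric[OF fder \<open>linear H\<close> approx])
  have psd: "0 \<le> H x \<bullet> x" for x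
    using fder \<open>linear H\<close> approx \<open>r0 > 0\<close> lmin \<open>g xs = 0\<close> by (rule hessian_psd_at_local_min)
  obtain h where "H h \<noteq> 0"
    using hessian_nonzero_under_PL[OF fder approx \<open>r0 > 0\<close> lmin \<open>g xs = 0\<close> \<open>\<nu> > 0\<close> PL nonconst] by blast
  note coercive = smallest_nonzero_eigenvalue_coercive[of "hessian f xs" h,
      folded A_def[THEN fun_cong, THEN fun_cong], folded H_def, folded \<mu>, OF sym psd \<open>H h \<noteq> 0\<close>]
  show "0 < \<mu>" by (rule coercive(1))
  assume "0 < \<gamma>" "0 < \<epsilon>" "\<epsilon> < rate \<mu> \<gamma>"
  obtain r1 where "r1 > 0" and r1: "\<And>x y. x \<in> cball xs r1 \<Longrightarrow> y \<in> cball xs r1 \<Longrightarrow>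
      norm (g x - g y - H (x - y)) \<le> 1 * norm (x - y)"
    using approx[OF zero_less_one] by blast
  obtain r2 where "r2 > 0" and r2: "\<And>y h. dist y xs < r2 \<Longrightarrow> norm (A y h - A xs h) \<le> 1 * norm h"
    using Acont[OF zero_less_one] by blast
  define R0 where "R0 = min (min r0 r1) r2 / 2"
  have R0: "R0 > 0" "2 * R0 \<le> r0" "2 * R0 \<le> r1" "R0 < r2" "R0 \<le> r0"
    using \<open>r0 > 0\<close> \<open>r1 > 0\<close> \<open>r2 > 0\<close> by (auto simp: R0_def)
  define L where "L = B + 2 * 1"
  have "L > 0" using \<open>B > 0\<close> by (simp add: L_def)
  have gsq: "(norm (g x))\<^sup>2 \<le> 2 * L * (f x - f xs)" and glin: "norm (g x) \<le> L * norm (x - xs)"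
    if "x \<in> cball xs R0" for x
  proof -
    have x: "x \<in> cball xs ((2 * R0) / 2)" using that by simp
    have r1': "norm (g x - g y - H (x - y)) \<le> 1 * norm (x - y)"
      if "x \<in> cball xs (2 * R0)" "y \<in> cball xs (2 * R0)" for x y
      using that R0 by (intro r1) auto
    have lmin': "f xs \<le> f y" if "y \<in> cball xs (2 * R0)" for y
      using that R0 by (intro lmin) auto
    note gap = gradient_squared_le_gap[OF fder \<open>linear H\<close> zero_less_one less_imp_le[OF \<open>B > 0\<close>] B r1' lmin'
        \<open>g xs = 0\<close> x]
    show "(norm (g x))\<^sup>2 \<le> 2 * L * (f x - f xs)" "norm (g x) \<le> L * norm (x - xs)"
      unfolding L_def by (rule gap; assumption)+
  qed
  have Abound: "norm (A x h) \<le> L * norm h" if "x \<in> cball xs R0" for x h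
  proof -
    have "norm (A x h) \<le> norm (A x h - A xs h) + norm (A xs h)"
      using norm_triangle_ineq[of "A x h - A xs h" "A xs h"] by simp
    also have "\<dots> \<le> 1 * norm h + B * norm h"
      using that R0 B[of h] by (intro add_mono r2) (auto simp: H_def dist_commute)
    also have "\<dots> \<le> L * norm h" by (simp add: L_def algebra_simps)
    finally show ?thesis .
  qed
  have lminR0: "f xs \<le> f y" and PLR0: "2 * \<nu> * (f y - f xs) \<le> (norm (g y))\<^sup>2" if "y \<in> cball xs R0" for y
    using that R0 lmin[of y] PL[of y] by auto
  obtain c where "c > 0" and basin: "\<And>R. 0 < R \<Longrightarrow> R \<le> R0 \<Longrightarrow>
        \<exists>d>0. \<forall>G x v. (\<forall>y\<in>cball xs R. G y = g y) \<longrightarrow> damped_flow G \<gamma> x v \<longrightarrow>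
          dist (x 0) xs < d \<longrightarrow> norm (v 0) < d \<longrightarrow>
          (\<forall>t\<ge>0. x t \<in> ball xs R) \<and>
          (\<exists>z D. (x \<longlongrightarrow> z) at_top \<and> f z = f xs \<and>
             (\<forall>t\<ge>0. norm (x t - z) \<le> D * exp (- c * t) \<and> norm (v t) \<le> D * exp (- c * t)))"
    by (rule PL_flow_converges_near_minimizer[OF fder gder \<open>L > 0\<close> \<open>\<nu> > 0\<close> \<open>0 < \<gamma>\<close> lminR0 PLR0 gsq glin Abound])
      (assumption | rule that)+
  \<comment> \<open>One half of \<open>\<epsilon>\<close> makes \<open>a\<close> smaller than the rate, the other half pays for the coupling \<open>\<eta>\<close>.\<close>
  define a where "a = rate \<mu> \<gamma> - \<epsilon> / 2"
  have "0 < a" "a < rate \<mu> \<gamma>" using \<open>0 < \<epsilon>\<close> \<open>\<epsilon> < rate \<mu> \<gamma>\<close> by (auto simp: a_def)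
  define \<eta> where "\<eta> = min (\<epsilon> / 2) (min (a / 2) (c / 2))"
  have \<eta>: "0 < \<eta>" "2 * \<eta> \<le> a" "\<eta> < c" "\<eta> \<le> \<epsilon> / 2"
    using \<open>0 < a\<close> \<open>c > 0\<close> \<open>0 < \<epsilon>\<close> by (auto simp: \<eta>_def)
  obtain C \<delta> where "C > 0" "\<delta> > 0" and sharp: "\<And>G x v z D t. damped_flow G \<gamma> x v \<Longrightarrow>
       (\<And>t. 0 \<le> t \<Longrightarrow> norm (G (x t) - H (x t - z)) \<le> \<delta> * norm (x t - z)) \<Longrightarrow>
       (\<And>t. 0 \<le> t \<Longrightarrow> norm (x t - z) \<le> D * exp (- c * t) \<and> norm (v t) \<le> D * exp (- c * t)) \<Longrightarrow>
       0 \<le> t \<Longrightarrow> norm (x t - z) \<le> C * (norm (x 0 - z) + norm (v 0)) * exp (- (a - \<eta>) * t)"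
    using sharp_rate_of_perturbed_flow[OF \<open>linear H\<close> sym coercive(2) \<open>0 < a\<close>
        below_rate[OF \<open>0 < a\<close> \<open>a < rate \<mu> \<gamma>\<close>] \<eta>(1,2,3)] by blast
  obtain r3 where "r3 > 0" and r3: "\<And>x y. x \<in> cball xs r3 \<Longrightarrow> y \<in> cball xs r3 \<Longrightarrow>
      norm (g x - g y - H (x - y)) \<le> \<delta> * norm (x - y)"
    using approx[OF \<open>\<delta> > 0\<close>] by blast
  define R where "R = min (R0 / 2) r3"
  have R: "0 < R" "R < R0" "R \<le> R0" "R \<le> r3" using R0(1) \<open>r3 > 0\<close> by (auto simp: R_def)
  obtain d where "d > 0" and d: "\<And>G x v. (\<forall>y\<in>cball xs R. G y = g y) \<Longrightarrow> damped_flow G \<gamma> x v \<Longrightarrow>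
          dist (x 0) xs < d \<Longrightarrow> norm (v 0) < d \<Longrightarrow>
          (\<forall>t\<ge>0. x t \<in> ball xs R) \<and>
          (\<exists>z D. (x \<longlongrightarrow> z) at_top \<and> f z = f xs \<and>
             (\<forall>t\<ge>0. norm (x t - z) \<le> D * exp (- c * t) \<and> norm (v t) \<le> D * exp (- c * t)))"
    using basin[OF R(1,3)] by blast
  have existence: "\<exists>x v. heavy_ball f \<gamma> x v \<and> x 0 = x0 \<and> v 0 = v0"
    if start: "dist x0 xs < d" "norm v0 < d" for x0 v0
  proof -
    define G where "G = (\<lambda>y. g (closest_point (cball xs R) y))"
    have ne: "cball xs R \<noteq> {}" using R by simp
    have G: "\<forall>y\<in>cball xs R. G y = g y" by (simp add: G_def closest_point_self)
    have lip: "norm (G x - G y) \<le> L * norm (x - y)" for x y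
    proof -
      let ?x = "closest_point (cball xs R) x" and ?y = "closest_point (cball xs R) y"
      have "?x \<in> cball xs R" "?y \<in> cball xs R"
        using closest_point_in_set[OF closed_cball ne] by auto
      then have xy: "?x \<in> cball xs r1" "?y \<in> cball xs r1"
        using R R0 by auto
      have "norm (G x - G y) \<le> norm (g ?x - g ?y - H (?x - ?y)) + norm (H (?x - ?y))"
        using norm_triangle_ineq[of "g ?x - g ?y - H (?x - ?y)" "H (?x - ?y)"] by (simp add: G_def)
      also have "\<dots> \<le> 1 * norm (?x - ?y) + B * norm (?x - ?y)"
        using r1[OF xy] B by (intro add_mono)
      also have "\<dots> \<le> L * norm (?x - ?y)" by (simp add: L_def algebra_simps)
      also have "\<dots> \<le> L * norm (x - y)"
        using closest_point_lipschitz[OF convex_cball closed_cball ne, of x y] \<open>L > 0\<close>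
        by (intro mult_left_mono) (auto simp: dist_norm)
      finally show ?thesis .
    qed
    obtain x v where flow: "damped_flow G \<gamma> x v" and x0: "x 0 = x0" and v0: "v 0 = v0"
      using damped_flow_exists[OF less_imp_le[OF \<open>L > 0\<close>] lip] by blast
    have "x t \<in> ball xs R" if "0 \<le> t" for t
      using d[OF G flow] start x0 v0 that by blast
    then have "G (x t) = grad f (x t)" if "0 \<le> t" for t
      using G that unfolding g_def by (metis ball_subset_cball subsetD)
    with flow have "heavy_ball f \<gamma> x v"
      unfolding heavy_ball_iff_damped_flow by (rule damped_flow_cong)
    with x0 v0 show ?thesis by blast
  qed
  have convergence: "\<exists>xs'\<in>minimizer_set f xs. (x \<longlongrightarrow> xs') at_top \<and>
      (\<forall>t\<ge>0. norm (x t - xs') \<le> C * (norm (x 0 - xs') + norm (v 0)) * exp (- (rate \<mu> \<gamma> - \<epsilon>) * t))"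
    if hb: "heavy_ball f \<gamma> x v" and start: "dist (x 0) xs < d" "norm (v 0) < d" for x v
  proof -
    have flow: "damped_flow g \<gamma> x v" using hb by (simp add: heavy_ball_iff_damped_flow g_def)
    obtain z D where inside: "\<And>t. 0 \<le> t \<Longrightarrow> x t \<in> ball xs R" and lim: "(x \<longlongrightarrow> z) at_top" and fz: "f z = f xs"
      and decay: "\<And>t. 0 \<le> t \<Longrightarrow> norm (x t - z) \<le> D * exp (- c * t) \<and> norm (v t) \<le> D * exp (- c * t)"
      using d[OF _ flow start] by blast
    have z: "z \<in> cball xs R"
    proof (rule Lim_in_closed_set[OF closed_cball _ _ lim])
      show "\<forall>\<^sub>F t in at_top. x t \<in> cball xs R"
        using eventually_ge_at_top[of 0] by eventually_elim (use inside in fastforce)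
    qed simp
    have zball: "z \<in> ball xs R0" using z R by auto
    have zmin: "f z \<le> f y" if "y \<in> ball xs R0" for y
      using lminR0[of y] that fz by auto
    have "z \<in> minimizer_set f xs"
      unfolding minimizer_set_def local_minimizer_def using fz zball zmin open_ball by blast
    moreover have "norm (x t - z) \<le> C * (norm (x 0 - z) + norm (v 0)) * exp (- (rate \<mu> \<gamma> - \<epsilon>) * t)"
      if "0 \<le> t" for t
    proof -
      have "g z = 0" using gradient_zero_at_local_min[OF fder open_ball zball zmin] .
      have small: "norm (g (x t) - H (x t - z)) \<le> \<delta> * norm (x t - z)" if "0 \<le> t" for t
        using r3[of "x t" z] inside[OF that] z R \<open>g z = 0\<close> by auto
      have "norm (x t - z) \<le> C * (norm (x 0 - z) + norm (v 0)) * exp (- (a - \<eta>) * t)"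
        by (rule sharp[OF flow small decay that])
      also have "\<dots> \<le> C * (norm (x 0 - z) + norm (v 0)) * exp (- (rate \<mu> \<gamma> - \<epsilon>) * t)"
      proof (intro mult_left_mono)
        have "(rate \<mu> \<gamma> - \<epsilon>) * t \<le> (a - \<eta>) * t"
          using \<eta>(4) \<open>0 \<le> t\<close> by (intro mult_right_mono) (auto simp: a_def)
        then show "exp (- (a - \<eta>) * t) \<le> exp (- (rate \<mu> \<gamma> - \<epsilon>) * t)"
          by (simp add: algebra_simps)
      qed (use \<open>C > 0\<close> in auto)
      finally show ?thesis .
    qed
    ultimately show ?thesis using lim by blast
  qed
  show "\<exists>U C. open U \<and> (xs, 0) \<in> U \<and> C > 0 \<and>
         (\<forall>x0 v0. (x0, v0) \<in> U \<longrightarrow>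
           (\<exists>x v. heavy_ball f \<gamma> x v \<and> x 0 = x0 \<and> v 0 = v0) \<and>
           (\<forall>x v. heavy_ball f \<gamma> x v \<and> x 0 = x0 \<and> v 0 = v0 \<longrightarrow>
             (\<exists>xs'\<in>minimizer_set f xs. (x \<longlongrightarrow> xs') at_top \<and>
               (\<forall>t\<ge>0. norm (x t - xs')
                  \<le> C * (norm (x 0 - xs') + norm (v 0)) * exp (- (rate \<mu> \<gamma> - \<epsilon>) * t)))))"
  proof (rule exI[of _ "ball xs d \<times> ball 0 d"], rule exI[of _ C], intro conjI allI impI)
    show "open (ball xs d \<times> ball (0 :: real ^ 'n) d)" by (intro open_Times open_ball)
    show "(xs, 0) \<in> ball xs d \<times> ball (0 :: real ^ 'n) d" using \<open>d > 0\<close> by simp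
    show "0 < C" by fact
    fix x0 v0 :: "real ^ 'n" assume "(x0, v0) \<in> ball xs d \<times> ball 0 d"
    then have start: "dist x0 xs < d" "norm v0 < d" by (auto simp: dist_commute)
    then show "\<exists>x v. heavy_ball f \<gamma> x v \<and> x 0 = x0 \<and> v 0 = v0" by (rule existence)
    fix x v assume "heavy_ball f \<gamma> x v \<and> x 0 = x0 \<and> v 0 = v0"
    with start show "\<exists>xs'\<in>minimizer_set f xs. (x \<longlongrightarrow> xs') at_top \<and>
        (\<forall>t\<ge>0. norm (x t - xs') \<le> C * (norm (x 0 - xs') + norm (v 0)) * exp (- (rate \<mu> \<gamma> - \<epsilon>) * t))"
      by (intro convergence) auto
  qed
qed

theorem theorem2p3:
  fixes f :: "real ^ 'n \<Rightarrow> real" and xs :: "real ^ 'n" and \<mu> \<gamma> :: real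
  assumes "C2 f"
    and "bdd_below (range f)"
    and "local_minimizer f xs"
    and "local_PL f xs"
    and nonconst: "\<not> (\<exists>V. open V \<and> xs \<in> V \<and> f constant_on V)"
    and mu: "\<mu> = smallest_nonzero_eigenvalue (hessian f xs)"
    and "\<gamma> > 0"
  shows
    "(\<exists>\<epsilon>0>0. \<forall>\<epsilon>. 0 < \<epsilon> \<and> \<epsilon> < \<epsilon>0 \<longrightarrow>
       (\<exists>U C. open U \<and> (xs, 0) \<in> U \<and> C > 0 \<and>
         (\<forall>x0 v0. (x0, v0) \<in> U \<longrightarrow>
           (\<exists>x v. heavy_ball f \<gamma> x v \<and> x 0 = x0 \<and> v 0 = v0) \<and>
           (\<forall>x v. heavy_ball f \<gamma> x v \<and> x 0 = x0 \<and> v 0 = v0 \<longrightarrow>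
             (\<exists>xs'\<in>minimizer_set f xs. (x \<longlongrightarrow> xs') at_top \<and>
               (\<forall>t\<ge>0. norm (x t - xs')
                  \<le> C * (norm (x 0 - xs') + norm (v 0)) * exp (- (rate \<mu> \<gamma> - \<epsilon>) * t)))))))
     \<and> is_arg_max (rate \<mu>) (\<lambda>\<gamma>'. \<gamma>' > 0) (2 * sqrt \<mu>)
     \<and> rate \<mu> (2 * sqrt \<mu>) = sqrt \<mu>
     \<and> (\<exists>\<epsilon>0>0. \<forall>\<epsilon>. 0 < \<epsilon> \<and> \<epsilon> < \<epsilon>0 \<longrightarrow>
       (\<exists>U C. open U \<and> (xs, 0) \<in> U \<and> C > 0 \<and>
         (\<forall>x0 v0. (x0, v0) \<in> U \<longrightarrow>
           (\<exists>x v. heavy_ball f (2 * sqrt \<mu>) x v \<and> x 0 = x0 \<and> v 0 = v0) \<and>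
           (\<forall>x v. heavy_ball f (2 * sqrt \<mu>) x v \<and> x 0 = x0 \<and> v 0 = v0 \<longrightarrow>
             (\<exists>xs'\<in>minimizer_set f xs. (x \<longlongrightarrow> xs') at_top \<and>
               (\<forall>t\<ge>0. norm (x t - xs')
                  \<le> C * (norm (x 0 - xs') + norm (v 0)) * exp (- (sqrt \<mu> - \<epsilon>) * t)))))))"
proof (intro conjI)
  note facts = heavy_ball_local_rate[OF assms(1,3,4) nonconst mu]
  have "0 < \<mu>" by (rule facts(1))
  then have crit: "0 < 2 * sqrt \<mu>" and rate: "rate \<mu> (2 * sqrt \<mu>) = sqrt \<mu>"
    by (simp_all add: rate_at_critical_damping)
  show "rate \<mu> (2 * sqrt \<mu>) = sqrt \<mu>" by fact
  show "is_arg_max (rate \<mu>) (\<lambda>\<gamma>'. \<gamma>' > 0) (2 * sqrt \<mu>)"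
    unfolding is_arg_max_def rate using crit rate_le_sqrt[OF \<open>0 < \<mu>\<close>] by (metis not_less)
  show "\<exists>\<epsilon>0>0. \<forall>\<epsilon>. 0 < \<epsilon> \<and> \<epsilon> < \<epsilon>0 \<longrightarrow>
       (\<exists>U C. open U \<and> (xs, 0) \<in> U \<and> C > 0 \<and>
         (\<forall>x0 v0. (x0, v0) \<in> U \<longrightarrow>
           (\<exists>x v. heavy_ball f \<gamma> x v \<and> x 0 = x0 \<and> v 0 = v0) \<and>
           (\<forall>x v. heavy_ball f \<gamma> x v \<and> x 0 = x0 \<and> v 0 = v0 \<longrightarrow>
             (\<exists>xs'\<in>minimizer_set f xs. (x \<longlongrightarrow> xs') at_top \<and>
               (\<forall>t\<ge>0. norm (x t - xs')
                  \<le> C * (norm (x 0 - xs') + norm (v 0)) * exp (- (rate \<mu> \<gamma> - \<epsilon>) * t))))))"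
    by (rule exI[of _ "rate \<mu> \<gamma>"], intro conjI allI impI rate_pos \<open>0 < \<mu>\<close> \<open>\<gamma> > 0\<close>)
      (rule facts(2)[OF \<open>\<gamma> > 0\<close>], simp_all)
  show "\<exists>\<epsilon>0>0. \<forall>\<epsilon>. 0 < \<epsilon> \<and> \<epsilon> < \<epsilon>0 \<longrightarrow>
       (\<exists>U C. open U \<and> (xs, 0) \<in> U \<and> C > 0 \<and>
         (\<forall>x0 v0. (x0, v0) \<in> U \<longrightarrow>
           (\<exists>x v. heavy_ball f (2 * sqrt \<mu>) x v \<and> x 0 = x0 \<and> v 0 = v0) \<and>
           (\<forall>x v. heavy_ball f (2 * sqrt \<mu>) x v \<and> x 0 = x0 \<and> v 0 = v0 \<longrightarrow>
             (\<exists>xs'\<in>minimizer_set f xs. (x \<longlongrightarrow> xs') at_top \<and>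
               (\<forall>t\<ge>0. norm (x t - xs')
                  \<le> C * (norm (x 0 - xs') + norm (v 0)) * exp (- (sqrt \<mu> - \<epsilon>) * t))))))"
    by (rule exI[of _ "sqrt \<mu>"], intro conjI allI impI)
      (use \<open>0 < \<mu>\<close> in simp, rule facts(2)[OF crit, unfolded rate], simp_all)
qed

end
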